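(* Let $d\ge 2$ and $\sigma>0$ satisfy $\sigma\sqrt{\ln(4/\sigma)}\le \frac{1}{32d}$, and let $n=\lfloor (4/\sigma)^d\rfloor$. There exist $\bar A\in\mathbb{R}^{n\times d}$ and $\bar b\in\mathbb{R}^n$ such that each row of the combined matrix $(\bar A,\bar b)$ has Euclidean norm at most $1$ and the following holds. If $A\in\mathbb{R}^{n\times d}$, $b\in\mathbb{R}^n$ have independent Gaussian entries with variance $\sigma^2$ and expectations $\mathbb{E}[A]=\bar A$, $\mathbb{E}[b]=\bar b$, then \[ \Pr\left[\operatorname{diam}(\{x: Ax\le b\}) \ge \frac{(d-1)^{1/2}}{24\sqrt{\sigma\sqrt{\ln(4/\sigma)}}}\right]\ge 1-n^{-d}. \] Moreover, with probability at least $1-n^{-d}$, for every nonzero objective $c\in\mathbb{R}^d$, the combinatorial distance between a maximizing vertex and a minimizing vertex of $c$ over $\{x:Ax\le b\}$ is at least $\frac{(d-1)^{1/2}}{24\sqrt{\sigma\sqrt{\ln(4/\sigma)}}}$.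
   Context: The combinatorial distance between two vertices of a polyhedron is the minimum number of edges of a path between them in the graph of vertices and edges of the polyhedron; the combinatorial diameter $\operatorname{diam}$ is the maximum combinatorial distance over all pairs of vertices. *)

theory Defs
  imports "HOL-Analysis.Analysis" "HOL-Probability.Probability"
begin

definition poly_vertices :: "'a::real_vector set \<Rightarrow> 'a set" where
  "poly_vertices P = {x. x extreme_point_of P}"

definition poly_adjacent :: "'a::real_vector set \<Rightarrow> 'a \<Rightarrow> 'a \<Rightarrow> bool" where
  "poly_adjacent P u v \<longleftrightarrow> u \<in> poly_vertices P \<and> v \<in> poly_vertices P \<and> u \<noteq> v
     \<and> closed_segment u v face_of P"

definition poly_walk :: "'a::real_vector set \<Rightarrow> 'a \<Rightarrow> 'a \<Rightarrow> nat \<Rightarrow> bool" where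
  "poly_walk P u v k \<longleftrightarrow> (\<exists>p :: nat \<Rightarrow> 'a. p 0 = u \<and> p k = v
      \<and> (\<forall>i<k. poly_adjacent P (p i) (p (Suc i))))"

text \<open>Combinatorial distance (infinite if no path exists).\<close>
definition comb_dist :: "'a::real_vector set \<Rightarrow> 'a \<Rightarrow> 'a \<Rightarrow> enat" where
  "comb_dist P u v = (INF k \<in> {k. poly_walk P u v k}. enat k)"

definition comb_diam :: "'a::real_vector set \<Rightarrow> enat" where
  "comb_diam P = (SUP u \<in> poly_vertices P. SUP v \<in> poly_vertices P. comb_dist P u v)"

definition polyhedron_of :: "real^'d^'n \<Rightarrow> real^'n \<Rightarrow> (real^'d) set" where
  "polyhedron_of A b = {x. \<forall>i. (A *v x) $ i \<le> b $ i}"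

text \<open>Entries of (A,b) as a single random vector: Inl (i,j) is A_ij, Inr i is b_i.\<close>
definition mat_of :: "(('n \<times> 'd) + 'n \<Rightarrow> real) \<Rightarrow> real^'d^'n" where
  "mat_of \<omega> = (\<chi> i j. \<omega> (Inl (i, j)))"

definition vec_of :: "(('n \<times> 'd) + 'n \<Rightarrow> real) \<Rightarrow> real^'n" where
  "vec_of \<omega> = (\<chi> i. \<omega> (Inr i))"

definition gauss_model :: "real^'d^'n \<Rightarrow> real^'n \<Rightarrow> real
     \<Rightarrow> (('n::finite \<times> 'd::finite) + 'n \<Rightarrow> real) measure" where
  "gauss_model Abar bbar \<sigma> =
     PiM UNIV (\<lambda>k. density lborel (normal_density
        (case k of Inl (i, j) \<Rightarrow> Abar $ i $ j | Inr i \<Rightarrow> bbar $ i) \<sigma>))"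

end

theory Submission
  imports Defs
begin

text \<open>The means of the rows are \<open>(w, 1) / sqrt 2\<close> for the points \<open>w\<close> of a \<open>\<sigma>\<close>-net of the unit sphere, which
  exists by a volume bound.  With \<open>s = \<sigma> sqrt (ln (4 / \<sigma>))\<close>, an exponential moment bound shows that all
  rows are perturbed by at most \<open>9 d s / 4\<close>, so that the polyhedron lies between balls of radii
  \<open>r = 1 - O(d s)\<close> and \<open>R = 1 + O(d s)\<close>, and almost surely every vertex has exactly \<open>d\<close> tight rows.
  Then any \<open>d - 1\<close> consecutive edges of a path share a tight row.  Hence they stay in one facet,
  whose diameter is at most \<open>2 sqrt (R\<^sup>2 - r\<^sup>2) = O(sqrt (d s))\<close>, while the maximizer and the minimizer of an
  objective are at distance at least \<open>2 r\<close>.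

  The probability measure is not completed, so both events must be shown to be Borel.  Vertices are
  parametrized by their sets of tight rows through least squares solutions, and vertices and edges
  are then recognized by Gram determinants.\<close>

subsection \<open>Vertices and edges\<close>

text \<open>Origin of the bound: crossing the polyhedron takes on the order of
  \<open>1 / sqrt (d * s)\<close> facets, each worth \<open>d - 1\<close> edges, and
  \<open>(d - 1) / sqrt (d * s)\<close> is of order \<open>sqrt (d - 1) / sqrt s\<close>. Origin of
  \<open>s\<close>: a tail of order \<open>exp (- t\<^sup>2 / \<sigma>\<^sup>2)\<close> for one row
  must beat \<open>n ^ (d + 1)\<close> to survive the union bound over \<open>n\<close> rows with
  failure probability \<open>1 / n ^ d\<close>. Since \<open>ln n\<close> is about
  \<open>d * ln (4 / \<sigma>)\<close>, this forces \<open>t\<close> to be of order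
  \<open>d * s\<close>. The net itself costs only \<open>\<sigma>\<^sup>2 / 2\<close> in the outer
  radius, by curvature of the sphere, which is negligible against \<open>d * s\<close>. The factor
  \<open>1 / sqrt 2\<close> gives every mean row \<open>(A, b)\<close> length exactly 1 and makes
  the mean polyhedron circumscribe the unit ball. Measurability cannot be skipped, since
  \<open>measure\<close> is 0 on sets that are not measurable. The second event quantifies over
  uncountably many objectives; Farkas' lemma replaces them by multipliers, and bounding the
  multipliers by integers leaves a countable union of closed sets.\<close>

definition tight_rows :: "real^'d^'n \<Rightarrow> real^'n \<Rightarrow> real^'d \<Rightarrow> 'n set" where
  "tight_rows A b x = {i. A $ i \<bullet> x = b $ i}"

lemma polyhedron_of_iff: "x \<in> polyhedron_of A b \<longleftrightarrow> (\<forall>i. A $ i \<bullet> x \<le> b $ i)"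
  by (simp add: polyhedron_of_def matrix_vector_mul_component)

lemma convex_polyhedron_of: "convex (polyhedron_of A b)"
proof -
  have "polyhedron_of A b = (\<Inter>i. {x. A $ i \<bullet> x \<le> b $ i})"
    by (auto simp: polyhedron_of_iff)
  then show ?thesis by (simp add: convex_INT convex_halfspace_le)
qed

lemma closed_polyhedron_of: "closed (polyhedron_of A b)"
proof -
  have "polyhedron_of A b = (\<Inter>i. {x. A $ i \<bullet> x \<le> b $ i})"
    by (auto simp: polyhedron_of_iff)
  then show ?thesis by (simp add: closed_INT closed_halfspace_le)
qed

text \<open>Rows with slack keep it for small steps by continuity, tight rows do not increase along
  \<open>z\<close>, and finitely many eventual statements combine. The one-sided filter suits the
  Farkas argument, where tight rows may strictly decrease.\<close>

lemma feasible_direction: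
  fixes A :: "real^'d^'n"
  assumes x: "x \<in> polyhedron_of A b" and z: "\<And>i. i \<in> tight_rows A b x \<Longrightarrow> A $ i \<bullet> z \<le> 0"
  shows "\<forall>\<^sub>F t in at_right 0. x + t *\<^sub>R z \<in> polyhedron_of A b"
proof -
  have "\<forall>\<^sub>F t in at_right 0. A $ i \<bullet> (x + t *\<^sub>R z) \<le> b $ i" for i
  proof (cases "i \<in> tight_rows A b x")
    case True
    have "\<forall>\<^sub>F t in at_right (0::real). t > 0" by (simp add: eventually_at_right_less)
    then show ?thesis
    proof eventually_elim
      case (elim t)
      with True z[OF True] show ?case
        by (simp add: tight_rows_def inner_add_right mult_nonneg_nonpos)
    qed
  next
    case False
    with x have "A $ i \<bullet> x < b $ i"
      by (auto simp: tight_rows_def polyhedron_of_iff order.strict_iff_order)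
    moreover have "((\<lambda>t. A $ i \<bullet> (x + t *\<^sub>R z)) \<longlongrightarrow> A $ i \<bullet> (x + 0 *\<^sub>R z)) (at_right 0)"
      by (intro tendsto_intros)
    ultimately have "\<forall>\<^sub>F t in at_right 0. A $ i \<bullet> (x + t *\<^sub>R z) < b $ i"
      by (intro order_tendstoD) auto
    then show ?thesis by eventually_elim simp
  qed
  then show ?thesis unfolding polyhedron_of_iff by (simp add: eventually_all_finite)
qed

lemma feasible_line:
  fixes A :: "real^'d^'n"
  assumes x: "x \<in> polyhedron_of A b" and z: "\<And>i. i \<in> tight_rows A b x \<Longrightarrow> A $ i \<bullet> z = 0"
  obtains t where "t > 0" "x + t *\<^sub>R z \<in> polyhedron_of A b" "x - t *\<^sub>R z \<in> polyhedron_of A b"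
proof -
  have "\<forall>\<^sub>F t in at_right 0. t > 0 \<and> x + t *\<^sub>R z \<in> polyhedron_of A b \<and> x + t *\<^sub>R (- z) \<in> polyhedron_of A b"
    using z by (intro eventually_conj feasible_direction x) (auto simp: eventually_at_right_less)
  then have "\<exists>t. t > 0 \<and> x + t *\<^sub>R z \<in> polyhedron_of A b \<and> x + t *\<^sub>R (- z) \<in> polyhedron_of A b"
    using eventually_happens trivial_limit_at_right_real by blast
  then show ?thesis using that by auto
qed

text \<open>The slack at \<open>x\<close> is a combination of two nonnegative slacks with positive
  weights, so if it vanishes both do.\<close>

lemma tight_at_interior_point:
  assumes "p \<in> polyhedron_of A b" "q \<in> polyhedron_of A b" "x \<in> open_segment p q"
    "i \<in> tight_rows A b x"
  shows "i \<in> tight_rows A b p" "i \<in> tight_rows A b q"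
proof -
  from assms(3) obtain u where u: "0 < u" "u < 1" "x = (1 - u) *\<^sub>R p + u *\<^sub>R q"
    by (auto simp: in_segment)
  have "(1 - u) * (A $ i \<bullet> p) + u * (A $ i \<bullet> q) = b $ i"
    using assms(4) u by (simp add: tight_rows_def inner_add_right)
  then have eq: "(1 - u) * (b $ i - A $ i \<bullet> p) + u * (b $ i - A $ i \<bullet> q) = 0"
    by (simp add: algebra_simps)
  moreover have "(1 - u) * (b $ i - A $ i \<bullet> p) \<ge> 0" "u * (b $ i - A $ i \<bullet> q) \<ge> 0"
    using assms(1,2) u by (auto simp: polyhedron_of_iff)
  ultimately have "(1 - u) * (b $ i - A $ i \<bullet> p) = 0" "u * (b $ i - A $ i \<bullet> q) = 0" by linarith+
  then show "i \<in> tight_rows A b p" "i \<in> tight_rows A b q"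
    using u by (auto simp: tight_rows_def)
qed

lemma centre_in_open_segment:
  fixes x w :: "'a::euclidean_space"
  assumes "w \<noteq> 0"
  shows "x \<in> open_segment (x - w) (x + w)"
proof -
  have "x - w \<noteq> x + w"
  proof
    assume "x - w = x + w"
    then have "2 *\<^sub>R w = 0" by (simp add: scaleR_2 algebra_simps)
    with assms show False by simp
  qed
  then have "midpoint (x - w) (x + w) \<in> open_segment (x - w) (x + w)"
    by simp
  moreover have "midpoint (x - w) (x + w) = x"
    by (simp add: midpoint_def flip: scaleR_2)
  ultimately show ?thesis by simp
qed

text \<open>A nonzero \<open>z\<close> killed by all tight rows would make \<open>x\<close> the
  centre of a feasible segment. Conversely, the ends of a segment through \<open>x\<close> share its
  tight rows, so their difference is killed by them.\<close>

lemma poly_vertices_iff: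
  fixes A :: "real^'d^'n"
  shows "x \<in> poly_vertices (polyhedron_of A b) \<longleftrightarrow>
    x \<in> polyhedron_of A b \<and> (\<forall>z. (\<forall>i\<in>tight_rows A b x. A $ i \<bullet> z = 0) \<longrightarrow> z = 0)"
proof (intro iffI conjI allI impI)
  assume x: "x \<in> poly_vertices (polyhedron_of A b)"
  then show xP: "x \<in> polyhedron_of A b" by (simp add: poly_vertices_def extreme_point_of_def)
  fix z assume "\<forall>i\<in>tight_rows A b x. A $ i \<bullet> z = 0"
  then obtain t where t: "t > 0" "x + t *\<^sub>R z \<in> polyhedron_of A b" "x - t *\<^sub>R z \<in> polyhedron_of A b"
    using feasible_line[OF xP] by blast
  show "z = 0"
  proof (rule ccontr)
    assume "z \<noteq> 0"
    with t have "x \<in> open_segment (x - t *\<^sub>R z) (x + t *\<^sub>R z)"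
      by (intro centre_in_open_segment) auto
    with x t show False by (auto simp: poly_vertices_def extreme_point_of_def)
  qed
next
  assume x: "x \<in> polyhedron_of A b \<and> (\<forall>z. (\<forall>i\<in>tight_rows A b x. A $ i \<bullet> z = 0) \<longrightarrow> z = 0)"
  have False if pq: "p \<in> polyhedron_of A b" "q \<in> polyhedron_of A b" "x \<in> open_segment p q" for p q
  proof -
    have "\<forall>i\<in>tight_rows A b x. A $ i \<bullet> (p - q) = 0"
      using tight_at_interior_point[OF pq] by (auto simp: tight_rows_def inner_diff_right)
    with x have "p - q = 0" by blast
    with pq(3) show False by simp
  qed
  with x show "x \<in> poly_vertices (polyhedron_of A b)"
    by (auto simp: poly_vertices_def extreme_point_of_def)
qed

text \<open>The common tight rows vanish exactly on the line through \<open>u - v\<close>.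
  Orthogonality to \<open>u - v\<close> is used instead of a span so that \<open>u - v\<close> acts
  as one more row, and a single determinant can decide the condition.\<close>

lemma poly_adjacent_iff:
  fixes A :: "real^'d^'n"
  shows "poly_adjacent (polyhedron_of A b) u v \<longleftrightarrow>
    u \<in> poly_vertices (polyhedron_of A b) \<and> v \<in> poly_vertices (polyhedron_of A b) \<and> u \<noteq> v \<and>
    (\<forall>z. (\<forall>i\<in>tight_rows A b u \<inter> tight_rows A b v. A $ i \<bullet> z = 0) \<and> (u - v) \<bullet> z = 0 \<longrightarrow> z = 0)"
    (is "?L \<longleftrightarrow> ?u \<and> ?v \<and> ?ne \<and> ?R")
proof -
  let ?P = "polyhedron_of A b"
  have "closed_segment u v face_of ?P \<longleftrightarrow> ?R" if uv: ?u ?v ?ne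
  proof
    assume F: "closed_segment u v face_of ?P"
    show ?R
    proof (intro allI impI)
      fix z assume z: "(\<forall>i\<in>tight_rows A b u \<inter> tight_rows A b v. A $ i \<bullet> z = 0) \<and> (u - v) \<bullet> z = 0"
      \<comment> \<open>A relative interior point of the edge: rows tight at \<open>m\<close> are
        tight at both ends, so \<open>m\<close> can be moved along \<open>z\<close> in both
        directions.\<close>
      define m where "m = midpoint u v"
      have m: "m \<in> open_segment u v" using uv by (simp add: m_def)
      have uvP: "u \<in> ?P" "v \<in> ?P" using uv by (auto simp: poly_vertices_iff)
      have mP: "m \<in> ?P" using m F face_of_imp_subset open_segment_def by blast
      have "A $ i \<bullet> z = 0" if "i \<in> tight_rows A b m" for i
        using z tight_at_interior_point[OF uvP m that] by auto
      then obtain t where t: "t > 0" "m + t *\<^sub>R z \<in> ?P" "m - t *\<^sub>R z \<in> ?P"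
        using feasible_line[OF mP] by blast
      show "z = 0"
      proof (rule ccontr)
        assume nz: "z \<noteq> 0"
        with t have "m \<in> open_segment (m - t *\<^sub>R z) (m + t *\<^sub>R z)"
          by (intro centre_in_open_segment) auto
        moreover have "m \<in> closed_segment u v" using m by (auto simp: open_segment_def)
        ultimately have "m + t *\<^sub>R z \<in> closed_segment u v"
          using F t unfolding face_of_def by blast
        then obtain s where s: "m + t *\<^sub>R z = (1 - s) *\<^sub>R u + s *\<^sub>R v" by (auto simp: in_segment)
        have "t *\<^sub>R z = (1/2 - s) *\<^sub>R (u - v)"
        proof -
          have "t *\<^sub>R z = (1 - s) *\<^sub>R u + s *\<^sub>R v - m" using s by (simp add: algebra_simps)
          also have "\<dots> = (1/2 - s) *\<^sub>R (u - v)"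
            unfolding m_def midpoint_def by (simp add: vec_eq_iff algebra_simps)
          finally show ?thesis .
        qed
        then have "(t *\<^sub>R z) \<bullet> (t *\<^sub>R z) = (1/2 - s) * ((u - v) \<bullet> (t *\<^sub>R z))" by simp
        also have "\<dots> = 0" using z by simp
        finally show False using t nz by simp
      qed
    qed
  next
    assume R: ?R
    have "p \<in> closed_segment u v" if pq: "p \<in> ?P" "q \<in> ?P" and x: "x \<in> closed_segment u v" "x \<in> open_segment p q"
      for p q x
    proof -
      have xt: "i \<in> tight_rows A b x" if "i \<in> tight_rows A b u \<inter> tight_rows A b v" for i
      proof -
        obtain s where "x = (1 - s) *\<^sub>R u + s *\<^sub>R v" using x(1) by (auto simp: in_segment)
        then have "A $ i \<bullet> x = (1 - s) * (A $ i \<bullet> u) + s * (A $ i \<bullet> v)"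
          by (simp add: inner_add_right)
        with that show ?thesis by (simp add: tight_rows_def algebra_simps)
      qed
      \<comment> \<open>Orthogonal projection of \<open>p - u\<close> onto the edge direction;
        \<open>z\<close> is the orthogonal remainder, which \<open>?R\<close> forces to be
        zero.\<close>
      define t where "t = (p - u) \<bullet> (v - u) / ((v - u) \<bullet> (v - u))"
      define z where "z = (p - u) - t *\<^sub>R (v - u)"
      have "A $ i \<bullet> z = 0" if i: "i \<in> tight_rows A b u \<inter> tight_rows A b v" for i
        using i tight_at_interior_point(1)[OF pq x(2) xt[OF i]]
        by (simp add: z_def tight_rows_def inner_diff_right)
      moreover have "(v - u) \<bullet> z = 0"
        using uv(3) by (simp add: z_def inner_diff_right[of _ "p-u"] t_def inner_commute)
      then have "(u - v) \<bullet> z = 0" by (metis inner_minus_left minus_diff_eq neg_equal_0_iff_equal)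
      ultimately have "z = 0" using R by blast
      then have p: "p = (1 - t) *\<^sub>R u + t *\<^sub>R v" by (simp add: z_def algebra_simps)
      have P: "u \<in> ?P" "v \<in> ?P" using uv by (auto simp: poly_vertices_iff)
      \<comment> \<open>Beyond either end of the segment, \<open>p\<close> would place that end
        strictly between two points of the polyhedron, against extremality.\<close>
      have "t \<ge> 0"
      proof (rule ccontr)
        assume t: "\<not> t \<ge> 0"
        define s where "s = - t / (1 - t)"
        have s: "0 < s" "s < 1" using t by (auto simp: s_def field_simps)
        have "(1 - s) * (1 - t) = 1" "(1 - s) * t + s = 0" using t by (auto simp: s_def field_simps)
        moreover have "(1 - s) *\<^sub>R p + s *\<^sub>R v = ((1 - s) * (1 - t)) *\<^sub>R u + ((1 - s) * t + s) *\<^sub>R v"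
          unfolding p by (simp add: algebra_simps)
        ultimately have "u = (1 - s) *\<^sub>R p + s *\<^sub>R v" by simp
        moreover have "p \<noteq> v"
        proof
          assume "p = v"
          moreover have "(1 - t) *\<^sub>R (u - v) = p - v" unfolding p by (simp add: algebra_simps)
          ultimately have "(1 - t) *\<^sub>R (u - v) = 0" by simp
          with t uv(3) show False by auto
        qed
        ultimately have "u \<in> open_segment p v" using s by (auto simp: in_segment)
        with uv(1) pq P show False by (auto simp: poly_vertices_def extreme_point_of_def)
      qed
      moreover have "t \<le> 1"
      proof (rule ccontr)
        assume t: "\<not> t \<le> 1"
        define s where "s = 1 / t"
        have s: "0 < s" "s < 1" using t by (auto simp: s_def field_simps)
        have "(1 - s) + s * (1 - t) = 0" "s * t = 1" using t by (auto simp: s_def field_simps)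
        moreover have "(1 - s) *\<^sub>R u + s *\<^sub>R p = ((1 - s) + s * (1 - t)) *\<^sub>R u + (s * t) *\<^sub>R v"
          unfolding p by (simp add: algebra_simps)
        ultimately have "v = (1 - s) *\<^sub>R u + s *\<^sub>R p" by simp
        moreover have "p \<noteq> u"
        proof
          assume "p = u"
          moreover have "t *\<^sub>R (u - v) = u - p" unfolding p by (simp add: algebra_simps)
          ultimately have "t *\<^sub>R (u - v) = 0" by simp
          with t uv(3) show False by auto
        qed
        ultimately have "v \<in> open_segment u p" using s by (auto simp: in_segment)
        with uv(2) pq P show False by (auto simp: poly_vertices_def extreme_point_of_def)
      qed
      ultimately show ?thesis using p by (auto simp: in_segment)
    qed
    moreover have "closed_segment u v \<subseteq> ?P"
      using uv by (intro closed_segment_subset convex_polyhedron_of) (auto simp: poly_vertices_iff)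
    ultimately show "closed_segment u v face_of ?P"
      unfolding face_of_def by (metis convex_closed_segment open_segment_commute)
  qed
  then show ?thesis by (auto simp: poly_adjacent_def)
qed

subsection \<open>Paths in round polyhedra\<close>

lemma orthogonal_vector_exists:
  fixes F :: "(real^'d) set"
  assumes "finite F" "card F < CARD('d)"
  obtains z where "z \<noteq> 0" "\<And>y. y \<in> F \<Longrightarrow> y \<bullet> z = 0"
proof -
  have "dim F < DIM(real^'d)"
    using assms dim_le_card'[of F] by simp
  then obtain z where "z \<noteq> 0" "\<And>y. y \<in> span F \<Longrightarrow> orthogonal z y"
    using orthogonal_to_subspace_exists by blast
  then show ?thesis
    using that by (metis inner_commute orthogonal_def span_base)
qed

lemma card_tight_rows_vertex:
  fixes A :: "real^'d^'n"
  assumes "u \<in> poly_vertices (polyhedron_of A b)"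
  shows "CARD('d) \<le> card (tight_rows A b u)"
proof (rule ccontr)
  assume "\<not> ?thesis"
  then have "card (($) A ` tight_rows A b u) < CARD('d)"
    using card_image_le[of "tight_rows A b u" "($) A"] by simp
  then obtain z where "z \<noteq> 0" "\<And>y. y \<in> ($) A ` tight_rows A b u \<Longrightarrow> y \<bullet> z = 0"
    using orthogonal_vector_exists[of "($) A ` tight_rows A b u"] by auto
  with assms show False by (auto simp: poly_vertices_iff)
qed

text \<open>The common tight rows together with \<open>u - v\<close> have trivial common kernel, so
  there are at least \<open>d\<close> of these vectors.\<close>

lemma card_tight_rows_adjacent:
  fixes A :: "real^'d^'n"
  assumes "poly_adjacent (polyhedron_of A b) u v"
  shows "CARD('d) \<le> Suc (card (tight_rows A b u \<inter> tight_rows A b v))"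
proof (rule ccontr)
  let ?K = "tight_rows A b u \<inter> tight_rows A b v"
  assume "\<not> ?thesis"
  then have "card (insert (u - v) (($) A ` ?K)) < CARD('d)"
    using card_image_le[of ?K "($) A"] card_insert_le_m1 by (auto simp: card_insert_if)
  then obtain z where "z \<noteq> 0" "\<And>y. y \<in> insert (u - v) (($) A ` ?K) \<Longrightarrow> y \<bullet> z = 0"
    using orthogonal_vector_exists[of "insert (u - v) (($) A ` ?K)"] by auto
  with assms show False by (auto simp: poly_adjacent_iff)
qed

text \<open>At most \<open>d\<close> rows are tight at \<open>p j\<close> and at least
  \<open>d - 1\<close> of them stay tight at the next vertex, so each edge removes at most one row
  from the running intersection.\<close>

lemma card_tight_rows_walk:
  fixes A :: "real^'d^'n"
  assumes nondeg: "\<And>x. x \<in> poly_vertices (polyhedron_of A b) \<Longrightarrow> card (tight_rows A b x) \<le> CARD('d)"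
    and p: "p 0 \<in> poly_vertices (polyhedron_of A b)"
    and adj: "\<And>i. i < j \<Longrightarrow> poly_adjacent (polyhedron_of A b) (p i) (p (Suc i))"
  shows "CARD('d) \<le> card (\<Inter>i\<le>j. tight_rows A b (p i)) + j"
  using adj
proof (induction j)
  case 0
  then show ?case using card_tight_rows_vertex[OF p] by simp
next
  case (Suc j)
  let ?T = "\<lambda>i. tight_rows A b (p i)" and ?S = "\<Inter>i\<le>j. tight_rows A b (p i)"
  have adj: "poly_adjacent (polyhedron_of A b) (p j) (p (Suc j))" using Suc.prems by simp
  have "card (?S - ?T (Suc j)) \<le> card (?T j - ?T (Suc j))"
    by (intro card_mono) auto
  also have "\<dots> = card (?T j) - card (?T j \<inter> ?T (Suc j))"
    by (simp add: card_Diff_subset_Int)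
  also have "\<dots> \<le> 1"
    using nondeg[of "p j"] card_tight_rows_adjacent[OF adj] adj by (auto simp: poly_adjacent_def)
  finally have "card (?S - ?T (Suc j)) \<le> 1" .
  moreover have "card ?S = card (?S - ?T (Suc j)) + card (?S \<inter> ?T (Suc j))"
    using card_Diff_subset_Int[of ?S "?T (Suc j)"] card_mono[of ?S "?S \<inter> ?T (Suc j)"] by auto
  moreover have "(\<Inter>i\<le>Suc j. ?T i) = ?S \<inter> ?T (Suc j)"
    by (auto simp: atMost_Suc)
  ultimately show ?case using Suc by simp
qed

text \<open>The midpoint of the chord lies on a hyperplane at distance at least \<open>r\<close>
  from the origin; the parallelogram law then bounds the chord.\<close>

lemma chord_in_facet:
  fixes a x y :: "'a::real_inner"
  assumes "a \<noteq> 0" "0 \<le> r" "norm a * r \<le> c" "a \<bullet> x = c" "a \<bullet> y = c" "norm x \<le> R" "norm y \<le> R"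
  shows "norm (x - y) \<le> 2 * sqrt (R\<^sup>2 - r\<^sup>2)"
proof -
  have "norm a * (2 * r) \<le> a \<bullet> (x + y)"
    using assms by (simp add: inner_add_right)
  also have "\<dots> \<le> norm a * norm (x + y)" by (rule norm_cauchy_schwarz)
  finally have "2 * r \<le> norm (x + y)" using assms by simp
  then have "(2 * r)\<^sup>2 \<le> (norm (x + y))\<^sup>2" using assms by (intro power_mono) auto
  moreover have "(norm (x - y))\<^sup>2 = 2 * (norm x)\<^sup>2 + 2 * (norm y)\<^sup>2 - (norm (x + y))\<^sup>2"
    by (simp add: power2_norm_eq_inner inner_simps inner_commute)
  moreover have "(norm x)\<^sup>2 \<le> R\<^sup>2" "(norm y)\<^sup>2 \<le> R\<^sup>2" using assms by (auto intro: power_mono)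
  ultimately have "(norm (x - y))\<^sup>2 \<le> 4 * (R\<^sup>2 - r\<^sup>2)" by (simp add: power_mult_distrib)
  then have "norm (x - y) \<le> sqrt (4 * (R\<^sup>2 - r\<^sup>2))" by (rule real_le_rsqrt)
  then show ?thesis unfolding real_sqrt_mult by simp
qed

text \<open>Each pivot exchanges a single row of a nondegenerate vertex, so any \<open>d - 1\<close> consecutive
  edges stay in a common facet.  This is what gains a factor \<open>d - 1\<close> over bounding single edges.\<close>

lemma walk_length_round:
  fixes A :: "real^'d^'n" and b :: "real^'n"
  defines "P \<equiv> polyhedron_of A b"
  assumes d: "CARD('d) \<ge> 2"
    and nondeg: "\<And>x. x \<in> poly_vertices P \<Longrightarrow> card (tight_rows A b x) \<le> CARD('d)"
    and r: "r > 0" "\<And>i. A $ i \<noteq> 0" "\<And>i. norm (A $ i) * r \<le> b $ i"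
    and R: "\<And>x. x \<in> P \<Longrightarrow> norm x \<le> R"
    and rR: "sqrt (R\<^sup>2 - r\<^sup>2) < r"
    and uv: "u \<in> poly_vertices P" "v \<in> poly_vertices P"
    and c: "c \<noteq> 0" "\<And>x. x \<in> P \<Longrightarrow> c \<bullet> x \<le> c \<bullet> u" "\<And>x. x \<in> P \<Longrightarrow> c \<bullet> v \<le> c \<bullet> x"
    and walk: "poly_walk P u v k"
  shows "(real CARD('d) - 1) * r \<le> 2 * sqrt (R\<^sup>2 - r\<^sup>2) * real k"
proof -
  define D where "D = 2 * sqrt (R\<^sup>2 - r\<^sup>2)"
  define m where "m = CARD('d) - 1"
  have m: "m \<ge> 1" "CARD('d) = Suc m" using d by (auto simp: m_def)
  obtain p where p: "p 0 = u" "p k = v" "\<And>i. i < k \<Longrightarrow> poly_adjacent P (p i) (p (Suc i))"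
    using walk by (auto simp: poly_walk_def)
  have vert: "p i \<in> poly_vertices P" if "i \<le> k" for i
    using that p uv by (cases "i = k") (auto simp: poly_adjacent_def)
  have vert_P: "x \<in> P" if "x \<in> poly_vertices P" for x
    using that by (simp add: P_def poly_vertices_iff)
  \<comment> \<open>Up to \<open>d - 1\<close> edges leave at least one row tight throughout, so
    both ends lie in one facet.\<close>
  have chunk: "norm (p s - p e) \<le> D" if "s \<le> e" "e \<le> k" "e - s \<le> m" for s e
  proof -
    have "CARD('d) \<le> card (\<Inter>i\<le>e-s. tight_rows A b (p (s + i))) + (e - s)"
    proof (rule card_tight_rows_walk)
      fix x assume "x \<in> poly_vertices (polyhedron_of A b)"
      then show "card (tight_rows A b x) \<le> CARD('d)" using nondeg by (simp add: P_def)
    qed (use that vert[of s] p(3) in \<open>auto simp: P_def\<close>)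
    with that m have "card (\<Inter>i\<le>e-s. tight_rows A b (p (s + i))) \<noteq> 0" by auto
    then have "(\<Inter>i\<le>e-s. tight_rows A b (p (s + i))) \<noteq> {}" by (metis card.empty)
    then obtain i where i: "\<And>j. j \<le> e - s \<Longrightarrow> i \<in> tight_rows A b (p (s + j))" by blast
    from i[of 0] i[of "e - s"] that have "A $ i \<bullet> p s = b $ i" "A $ i \<bullet> p e = b $ i"
      by (auto simp: tight_rows_def)
    then show ?thesis
      unfolding D_def using r that
      by (intro chord_in_facet[of "A $ i" r "b $ i"] R vert_P vert) (auto intro: less_imp_le)
  qed
  have D0: "D \<ge> 0" using chunk[of 0 0] by simp
  have dist: "norm (p 0 - p e) \<le> (real (e div m) + 1) * D" if "e \<le> k" for e
    using that
  proof (induction e rule: less_induct)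
    case (less e)
    show ?case
    proof (cases "e \<le> m")
      case True
      then have "norm (p 0 - p e) \<le> D" using chunk less.prems by simp
      also have "\<dots> \<le> (real (e div m) + 1) * D" using D0 by (simp add: mult_right_mono algebra_simps)
      finally show ?thesis .
    next
      case False
      then have "norm (p 0 - p (e - m)) \<le> (real ((e - m) div m) + 1) * D"
        using less m by auto
      moreover have "norm (p (e - m) - p e) \<le> D"
        using False less.prems by (intro chunk) auto
      moreover have "e div m = Suc ((e - m) div m)" using False m by (simp add: le_div_geq)
      moreover have "norm (p 0 - p e) \<le> norm (p 0 - p (e - m)) + norm (p (e - m) - p e)"
        using norm_triangle_ineq[of "p 0 - p (e - m)" "p (e - m) - p e"] by simp
      ultimately show ?thesis by (simp add: algebra_simps)
    qed
  qed
  \<comment> \<open>The ball of radius \<open>r\<close> lies in \<open>P\<close>, so the optimal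
    values of \<open>c\<close> are at least \<open>r * norm c\<close> and at most
    \<open>- r * norm c\<close>.\<close>
  have "2 * r \<le> norm (u - v)"
  proof -
    define w where "w = (r / norm c) *\<^sub>R c"
    have nw: "norm w = r" using c r by (simp add: w_def)
    have wP: "x \<in> P" if "norm x = r" for x
      unfolding P_def polyhedron_of_iff
    proof
      fix i
      have "A $ i \<bullet> x \<le> norm (A $ i) * r" using norm_cauchy_schwarz[of "A $ i" x] that by simp
      with r(3)[of i] show "A $ i \<bullet> x \<le> b $ i" by simp
    qed
    have cw: "c \<bullet> w = r * norm c" using c by (simp add: w_def dot_square_norm power2_eq_square)
    have "c \<bullet> w \<le> c \<bullet> u" "c \<bullet> v \<le> c \<bullet> (- w)"
      using c(2)[OF wP[of w]] c(3)[OF wP[of "- w"]] nw by auto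
    then have "2 * r * norm c \<le> c \<bullet> (u - v)" using cw by (simp add: inner_diff_right)
    also have "\<dots> \<le> norm c * norm (u - v)" by (rule norm_cauchy_schwarz)
    finally show ?thesis using c by simp
  qed
  \<comment> \<open>One facet is too short for the distance \<open>2 * r\<close>, by
    \<open>rR\<close>. This absorbs the rounding below: \<open>k / m + 1\<close> is at most
    \<open>2 * k / m\<close>.\<close>
  moreover have "m < k"
  proof (rule ccontr)
    assume "\<not> m < k"
    then have "norm (u - v) \<le> D" using chunk[of 0 k] p by simp
    with \<open>2 * r \<le> norm (u - v)\<close> rR show False by (simp add: D_def)
  qed
  moreover have "norm (u - v) \<le> (real (k div m) + 1) * D" using dist[of k] p by simp
  ultimately have "2 * r \<le> (real (k div m) + 1) * D" by linarith
  also have "\<dots> \<le> (real k / real m + 1) * D"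
    using D0 by (intro mult_right_mono add_right_mono of_nat_div_le_of_nat)
  also have "\<dots> \<le> (2 * (real k / real m)) * D"
    using D0 \<open>m < k\<close> m by (intro mult_right_mono) (auto simp: field_simps)
  finally have "real m * r \<le> D * real k" using m by (simp add: field_simps)
  then show ?thesis using m by (simp add: D_def)
qed

subsection \<open>Perturbing a spherical net\<close>

text \<open>Volume packing: the balls of radius \<open>e / 2\<close> around the points are disjoint
  and fit into the ball of radius \<open>1 + e / 2\<close>.\<close>

lemma separated_sphere_card_le:
  fixes F :: "(real^'d) set"
  assumes e: "e > 0" and F: "finite F" "F \<subseteq> sphere 0 1"
    and sep: "\<And>x y. x \<in> F \<Longrightarrow> y \<in> F \<Longrightarrow> x \<noteq> y \<Longrightarrow> e \<le> dist x y"
  shows "real (card F) \<le> (1 + 2 / e) ^ CARD('d)"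
proof -
  let ?V = "unit_ball_vol (real CARD('d))"
  have V: "?V > 0" by simp
  have disj: "disjoint_family_on (\<lambda>x. ball x (e/2)) F"
    unfolding disjoint_family_on_def
  proof (intro ballI impI equals0I)
    fix x y z assume "x \<in> F" "y \<in> F" "x \<noteq> y" "z \<in> ball x (e/2) \<inter> ball y (e/2)"
    with sep[of x y] dist_triangle[of x y z] show False by (auto simp: dist_commute)
  qed
  have "(\<Union>x\<in>F. ball x (e/2)) \<subseteq> ball (0::real^'d) (1 + e/2)"
  proof
    fix z assume "z \<in> (\<Union>x\<in>F. ball x (e/2))"
    then obtain x where x: "x \<in> F" "dist x z < e/2" by auto
    then have "norm x = 1" using F by auto
    with x norm_triangle_sub[of z x] show "z \<in> ball 0 (1 + e/2)"
      by (simp add: dist_norm norm_minus_commute)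
  qed
  then have "measure lborel (\<Union>x\<in>F. ball x (e/2)) \<le> measure lborel (ball (0::real^'d) (1 + e/2))"
    using e by (intro measure_mono_fmeasurable fmeasurableI) (auto simp: emeasure_ball intro!: borel_open)
  also have "measure lborel (\<Union>x\<in>F. ball x (e/2)) = (\<Sum>x\<in>F. measure lborel (ball x (e/2)))"
    using e by (intro measure_finite_Union F disj) (auto simp: emeasure_ball)
  finally have "real (card F) * (?V * (e/2) ^ CARD('d)) \<le> ?V * (1 + e/2) ^ CARD('d)"
    using e by (simp add: content_ball)
  then have "real (card F) * (e/2) ^ CARD('d) \<le> (1 + e/2) ^ CARD('d)"
    using V by (simp add: mult.left_commute)
  moreover have "(e/2) ^ CARD('d) > 0" using e by simp
  ultimately have "real (card F) \<le> (1 + e/2) ^ CARD('d) / (e/2) ^ CARD('d)"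
    by (simp only: pos_le_divide_eq)
  also have "\<dots> = ((1 + e/2) / (e/2)) ^ CARD('d)" by (rule power_divide[symmetric])
  also have "(1 + e/2) / (e/2) = 1 + 2 / e" using e by (simp add: field_simps)
  finally show ?thesis .
qed

text \<open>A separated set of maximal cardinality is a net, since an uncovered point could be added
  to it. The packing bound caps the cardinality by that of \<open>'n\<close>, so such a maximum
  exists and the index type is large enough.\<close>

lemma sphere_net_exists:
  fixes e :: real
  assumes e: "e > 0" and n: "(1 + 2 / e) ^ CARD('d::finite) < real CARD('n::finite) + 1"
  obtains w :: "'n::finite \<Rightarrow> real^'d::finite" where "\<And>i. norm (w i) = 1"
    "\<And>x. norm x = 1 \<Longrightarrow> \<exists>i. dist x (w i) < e"
proof -
  define \<F> where "\<F> = {F :: (real^'d) set. finite F \<and> F \<subseteq> sphere 0 1 \<and>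
      (\<forall>x\<in>F. \<forall>y\<in>F. x \<noteq> y \<longrightarrow> e \<le> dist x y)}"
  have card_le: "card F \<le> CARD('n)" if "F \<in> \<F>" for F
  proof -
    have "real (card F) \<le> (1 + 2 / e) ^ CARD('d)"
      using that by (intro separated_sphere_card_le e) (auto simp: \<F>_def)
    with n show ?thesis by linarith
  qed
  have "{} \<in> \<F>" by (simp add: \<F>_def)
  then have "\<exists>F. F \<in> \<F> \<and> (\<forall>G. G \<in> \<F> \<longrightarrow> card G \<le> card F)"
    using card_le by (intro ex_has_greatest_nat[where b = "Suc CARD('n)"]) (auto simp: less_Suc_eq_le)
  then obtain F where F: "F \<in> \<F>" and max: "\<And>G. G \<in> \<F> \<Longrightarrow> card G \<le> card F" by blast
  have fin: "finite F" and sph: "F \<subseteq> sphere 0 1" using F by (auto simp: \<F>_def)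
  have net: "\<exists>y\<in>F. dist x y < e" if x: "norm x = 1" for x
  proof (rule ccontr)
    assume "\<not> ?thesis"
    then have far: "\<And>y. y \<in> F \<Longrightarrow> e \<le> dist x y" by force
    then have "x \<notin> F" using e by force
    moreover have "insert x F \<in> \<F>"
      using F x far by (auto simp: \<F>_def dist_commute)
    ultimately show False using max[of "insert x F"] fin by simp
  qed
  obtain x0 :: "real^'d" where "norm x0 = 1" using vector_choose_size[of 1] by auto
  then have ne: "F \<noteq> {}" using net by blast
  obtain f where f: "inj_on f F" "f ` F \<subseteq> (UNIV :: 'n set)"
    using card_le_inj[OF fin finite card_le[OF F]] by blast
  \<comment> \<open>Surplus indices repeat an arbitrary point of the net.\<close>
  define w where "w i = (if i \<in> f ` F then inv_into F f i else SOME y. y \<in> F)" for i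
  have wF: "w i \<in> F" for i
    using ne by (auto simp: w_def inv_into_into some_in_eq)
  have "y \<in> range w" if "y \<in> F" for y
    using that f by (intro image_eqI[of _ _ "f y"]) (auto simp: w_def)
  with net wF sph show ?thesis by (intro that[of w]) fastforce+
qed

text \<open>After division by \<open>\<alpha>\<close>, noise of norm \<open>t\<close> costs
  \<open>2 * t\<close> in either radius, because \<open>sqrt 2 = 2 * \<alpha>\<close>. The outer
  radius also pays \<open>e\<^sup>2 / 2\<close> for replacing a direction by the nearest net
  point.\<close>

lemma perturbed_ball_bounds:
  fixes A :: "real^'d^'n" and b :: "real^'n" and w :: "'n \<Rightarrow> real^'d"
  defines "\<alpha> \<equiv> 1 / sqrt 2"
  assumes w: "\<And>i. norm (w i) = 1" and net: "\<And>x. norm x = 1 \<Longrightarrow> \<exists>i. dist x (w i) < e"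
    and t: "0 \<le> t" "2 * t + e\<^sup>2 / 2 < 1"
    and noise: "\<And>i. (norm (A $ i - \<alpha> *\<^sub>R w i))\<^sup>2 + (b $ i - \<alpha>)\<^sup>2 \<le> t\<^sup>2"
  shows "A $ i \<noteq> 0"
    and "norm (A $ i) * (1 - 2 * t) \<le> b $ i"
    and "x \<in> polyhedron_of A b \<Longrightarrow> norm x \<le> 1 / (1 - 2 * t - e\<^sup>2 / 2)"
proof -
  have a: "\<alpha> > 0" "\<alpha> * sqrt 2 = 1" "\<alpha>\<^sup>2 = 1/2" by (auto simp: \<alpha>_def power_divide)
  have sqrt2: "sqrt 2 = 2 * \<alpha>" by (simp add: \<alpha>_def real_div_sqrt)
  have t1: "2 * t < 1" using t zero_le_power2[of e] by linarith
  \<comment> \<open>Matrix and right-hand side noise form one vector, paired with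
    \<open>(y, - s)\<close>, so Cauchy-Schwarz is applied only once.\<close>
  have pert: "\<bar>(A $ i - \<alpha> *\<^sub>R w i) \<bullet> y - (b $ i - \<alpha>) * s\<bar> \<le> t * sqrt ((norm y)\<^sup>2 + s\<^sup>2)" for i y s
  proof -
    let ?g = "(A $ i - \<alpha> *\<^sub>R w i, b $ i - \<alpha>)"
    have "\<bar>?g \<bullet> (y, - s)\<bar> \<le> norm ?g * norm (y, - s)" by (rule Cauchy_Schwarz_ineq2)
    moreover have "norm ?g \<le> t"
      using noise[of i] t by (simp add: norm_prod_def real_le_lsqrt)
    then have "norm ?g * norm (y, - s) \<le> t * norm (y, - s)" by (rule mult_right_mono) simp
    ultimately show ?thesis by (simp add: norm_prod_def)
  qed
  have nA: "norm (A $ i) \<le> \<alpha> + norm (A $ i - \<alpha> *\<^sub>R w i)"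
    using norm_triangle_ineq[of "\<alpha> *\<^sub>R w i" "A $ i - \<alpha> *\<^sub>R w i"] w a by simp
  have nA': "norm (A $ i - \<alpha> *\<^sub>R w i) \<le> t"
  proof (rule power2_le_imp_le)
    show "(norm (A $ i - \<alpha> *\<^sub>R w i))\<^sup>2 \<le> t\<^sup>2"
      using noise[of i] zero_le_power2[of "b $ i - \<alpha>"] by linarith
  qed fact
  have "t < \<alpha>"
  proof -
    have "t < 1/2" using t1 by simp
    also have "1/2 < \<alpha>" unfolding \<alpha>_def by (simp add: field_simps sqrt2_less_2)
    finally show ?thesis .
  qed
  then show "A $ i \<noteq> 0"
    using nA' w[of i] a by auto
  have bi: "\<bar>b $ i - \<alpha>\<bar> \<le> t"
  proof (rule power2_le_imp_le)
    show "\<bar>b $ i - \<alpha>\<bar>\<^sup>2 \<le> t\<^sup>2"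
      using noise[of i] zero_le_power2[of "norm (A $ i - \<alpha> *\<^sub>R w i)"] unfolding power2_abs by linarith
  qed fact
  show "norm (A $ i) * (1 - 2 * t) \<le> b $ i"
  proof (cases "A $ i = 0")
    case True
    with bi \<open>t < \<alpha>\<close> show ?thesis by simp
  next
    case False
    define y where "y = ((1 - 2 * t) / norm (A $ i)) *\<^sub>R (A $ i)"
    have ny: "norm y = 1 - 2 * t" using False t1 by (simp add: y_def)
    have "norm (A $ i) * (1 - 2 * t) = A $ i \<bullet> y"
      using False by (simp add: y_def dot_square_norm power2_eq_square)
    also have "\<dots> = \<alpha> * (w i \<bullet> y) + (A $ i - \<alpha> *\<^sub>R w i) \<bullet> y"
      by (simp add: inner_diff_left)
    also have "\<alpha> * (w i \<bullet> y) \<le> \<alpha> * (1 - 2 * t)"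
      using norm_cauchy_schwarz[of "w i" y] w ny a by simp
    also have "(A $ i - \<alpha> *\<^sub>R w i) \<bullet> y \<le> (b $ i - \<alpha>) + t * sqrt ((norm y)\<^sup>2 + 1)"
      using pert[of i y 1] by simp
    also have "sqrt ((norm y)\<^sup>2 + 1) \<le> sqrt 2"
      using ny t t1 by (simp add: power_le_one)
    finally have "norm (A $ i) * (1 - 2 * t) \<le> \<alpha> * (1 - 2 * t) + (b $ i - \<alpha>) + t * sqrt 2"
      using t by (simp add: mult_left_mono)
    also have "t * sqrt 2 = 2 * (\<alpha> * t)"
      by (simp add: sqrt2)
    finally show ?thesis by (simp add: algebra_simps)
  qed
  assume x: "x \<in> polyhedron_of A b"
  have pos: "0 < 1 - 2 * t - e\<^sup>2 / 2" "1 - 2 * t - e\<^sup>2 / 2 \<le> 1"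
    using t zero_le_power2[of e] by linarith+
  show "norm x \<le> 1 / (1 - 2 * t - e\<^sup>2 / 2)"
  proof (cases "norm x \<le> 1")
    case True
    also have "1 \<le> 1 / (1 - 2 * t - e\<^sup>2 / 2)" using pos by simp
    finally show ?thesis .
  next
    case False
    then have x0: "norm x > 0" by linarith
    define y where "y = x /\<^sub>R norm x"
    have ny: "norm y = 1" using x0 by (simp add: y_def)
    obtain j where j: "dist y (w j) < e" using net[OF ny] by blast
    have "(norm (y - w j))\<^sup>2 \<le> e\<^sup>2" using j by (intro power_mono) (auto simp: dist_norm)
    moreover have "(norm (y - w j))\<^sup>2 = 2 - 2 * (w j \<bullet> y)"
      using ny w[of j] by (simp add: power2_norm_eq_inner inner_simps inner_commute norm_eq_1)
    ultimately have wy: "1 - e\<^sup>2 / 2 \<le> w j \<bullet> y" by simp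
    have "A $ j \<bullet> y = \<alpha> * (w j \<bullet> y) + (A $ j - \<alpha> *\<^sub>R w j) \<bullet> y"
      by (simp add: inner_diff_left)
    \<comment> \<open>The constraint is divided by \<open>norm x\<close>. The case
      \<open>norm x \<le> 1\<close> was split off so that \<open>s < 1\<close>, which keeps the
      noise factor below \<open>sqrt 2\<close>.\<close>
    define s where "s = 1 / norm x"
    have s: "0 < s" "s < 1" using False x0 by (auto simp: s_def)
    have "A $ j \<bullet> x \<le> b $ j" using x by (simp add: polyhedron_of_iff)
    then have "A $ j \<bullet> y \<le> b $ j * s"
      using x0 by (simp add: y_def s_def field_simps)
    moreover have "(A $ j - \<alpha> *\<^sub>R w j) \<bullet> y - (b $ j - \<alpha>) * s \<ge> - (t * sqrt 2)"
    proof -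
      have "t * sqrt ((norm y)\<^sup>2 + s\<^sup>2) \<le> t * sqrt 2"
        using s ny t by (intro mult_left_mono) (auto simp: power_le_one)
      with pert[of j y s] show ?thesis by linarith
    qed
    moreover have "\<alpha> * (1 - e\<^sup>2 / 2) \<le> \<alpha> * (w j \<bullet> y)" using wy a by simp
    moreover have "(b $ j - \<alpha>) * s = b $ j * s - \<alpha> * s" by (rule left_diff_distrib)
    moreover have "\<alpha> * (1 - 2 * t - e\<^sup>2 / 2) = \<alpha> * (1 - e\<^sup>2 / 2) - t * sqrt 2"
      unfolding sqrt2 by (simp add: right_diff_distrib)
    ultimately have "\<alpha> * (1 - 2 * t - e\<^sup>2 / 2) \<le> \<alpha> * s"
      using \<open>A $ j \<bullet> y = _\<close> by linarith
    then have "1 - 2 * t - e\<^sup>2 / 2 \<le> 1 / norm x"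
      by (simp only: s_def mult_le_cancel_left_pos[OF a(1)])
    then show ?thesis using pos x0 by (simp add: field_simps)
  qed
qed

subsection \<open>Algebraic description of vertices, edges and optimality\<close>

text \<open>With the vectors as rows of \<open>F\<close> this is the product of the transpose of
  \<open>F\<close> with \<open>F\<close>. It is square for every size of \<open>I\<close>, so
  spanning can be tested without selecting \<open>d\<close> independent rows.\<close>

definition gram :: "('i \<Rightarrow> real^'d) \<Rightarrow> 'i set \<Rightarrow> real^'d^'d" where
  "gram f I = (\<chi> k l. \<Sum>i\<in>I. f i $ k * f i $ l)"

lemma gram_mult_vector: "gram f I *v z = (\<Sum>i\<in>I. (f i \<bullet> z) *\<^sub>R f i)"
proof -
  have "(\<Sum>l\<in>UNIV. (\<Sum>i\<in>I. f i $ k * f i $ l) * z $ l) = (\<Sum>i\<in>I. (\<Sum>l\<in>UNIV. f i $ l * z $ l) * f i $ k)" for k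
    unfolding sum_distrib_right by (subst sum.swap) (simp add: mult_ac)
  then show ?thesis
    by (simp add: vec_eq_iff gram_def matrix_vector_mult_def inner_vec_def)
qed

text \<open>The quadratic form of the matrix at \<open>z\<close> is the sum of the squares of
  \<open>f i \<bullet> z\<close>, so its kernel is the common kernel of the vectors.\<close>

lemma det_gram_nonzero_iff:
  assumes "finite I"
  shows "det (gram f I) \<noteq> 0 \<longleftrightarrow> (\<forall>z. (\<forall>i\<in>I. f i \<bullet> z = 0) \<longrightarrow> z = 0)"
proof -
  have "gram f I *v z = 0 \<longleftrightarrow> (\<forall>i\<in>I. f i \<bullet> z = 0)" for z
  proof
    assume "gram f I *v z = 0"
    then have "z \<bullet> (gram f I *v z) = 0" by simp
    then have "(\<Sum>i\<in>I. (f i \<bullet> z)\<^sup>2) = 0"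
      by (simp add: gram_mult_vector inner_sum_right power2_eq_square inner_commute)
    with assms show "\<forall>i\<in>I. f i \<bullet> z = 0" by (simp add: sum_nonneg_eq_0_iff)
  qed (simp add: gram_mult_vector)
  moreover have "det (gram f I) \<noteq> 0 \<longleftrightarrow> (\<forall>z. gram f I *v z = 0 \<longrightarrow> z = 0)"
    by (simp only: invertible_det_nz[symmetric] invertible_left_inverse matrix_left_invertible_ker)
  ultimately show ?thesis by simp
qed

text \<open>The least squares solution of the rows in \<open>K\<close>, written out by Cramer's rule so that its
  entries are visibly measurable in the data.\<close>

definition basic_solution :: "real^'d^'n \<Rightarrow> real^'n \<Rightarrow> 'n set \<Rightarrow> real^'d" where
  "basic_solution A b K = (\<chi> k. det (\<chi> i j. if j = k then \<Sum>r\<in>K. b $ r * A $ r $ i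
     else gram (($) A) K $ i $ j) / det (gram (($) A) K))"

text \<open>A point solving all rows in \<open>K\<close> also solves the normal equations, whose
  only solution is the one given by Cramer's rule.\<close>

lemma basic_solution_unique:
  fixes A :: "real^'d^'n"
  assumes "det (gram (($) A) K) \<noteq> 0" "\<And>i. i \<in> K \<Longrightarrow> A $ i \<bullet> u = b $ i"
  shows "u = basic_solution A b K"
proof -
  have "gram (($) A) K *v u = (\<chi> i. \<Sum>r\<in>K. b $ r * A $ r $ i)"
    using assms(2) by (simp add: gram_mult_vector vec_eq_iff)
  then have "u = (\<chi> k. det (\<chi> i j. if j = k then (\<chi> i. \<Sum>r\<in>K. b $ r * A $ r $ i) $ i
     else gram (($) A) K $ i $ j) / det (gram (($) A) K))"
    using cramer[OF assms(1)] by blast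
  then show ?thesis by (simp add: basic_solution_def cong: if_cong)
qed

text \<open>Strictness outside \<open>K\<close> makes \<open>K\<close> the full tight set, so that
  every vertex has exactly one index set, even a degenerate one.\<close>

definition vertex_rows :: "real^'d^'n \<Rightarrow> real^'n \<Rightarrow> 'n set \<Rightarrow> bool" where
  "vertex_rows A b K \<longleftrightarrow> det (gram (($) A) K) \<noteq> 0 \<and>
     (\<forall>i. if i \<in> K then A $ i \<bullet> basic_solution A b K = b $ i
          else A $ i \<bullet> basic_solution A b K < b $ i)"

lemma vertex_rows_iff:
  fixes A :: "real^'d^'n"
  shows "vertex_rows A b K \<longleftrightarrow>
    basic_solution A b K \<in> poly_vertices (polyhedron_of A b) \<and>
    tight_rows A b (basic_solution A b K) = K"
proof -
  have "(\<forall>i. if i \<in> K then A $ i \<bullet> x = b $ i else A $ i \<bullet> x < b $ i) \<longleftrightarrow>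
      x \<in> polyhedron_of A b \<and> tight_rows A b x = K" for x
    unfolding polyhedron_of_iff tight_rows_def set_eq_iff mem_Collect_eq all_conj_distrib[symmetric]
    by (intro all_cong1) auto
  then show ?thesis
    by (auto simp: vertex_rows_def poly_vertices_iff det_gram_nonzero_iff)
qed

text \<open>Quantifiers over vertices thereby become quantifiers over finitely many sets of rows
  that do not depend on the sample.\<close>

lemma poly_vertices_eq:
  fixes A :: "real^'d^'n"
  shows "poly_vertices (polyhedron_of A b) = basic_solution A b ` {K. vertex_rows A b K}"
proof (intro set_eqI iffI)
  fix u assume u: "u \<in> poly_vertices (polyhedron_of A b)"
  then have "u = basic_solution A b (tight_rows A b u)"
    by (intro basic_solution_unique)
      (auto simp: det_gram_nonzero_iff poly_vertices_iff tight_rows_def)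
  then show "u \<in> basic_solution A b ` {K. vertex_rows A b K}"
    using u by (intro image_eqI[of _ _ "tight_rows A b u"]) (auto simp: vertex_rows_iff)
qed (auto simp: vertex_rows_iff)

text \<open>The index \<open>None\<close> carries \<open>u - v\<close> as the additional row of the
  edge criterion.\<close>

lemma poly_adjacent_basic_solution:
  fixes A :: "real^'d^'n"
  assumes "vertex_rows A b K" "vertex_rows A b L"
  shows "poly_adjacent (polyhedron_of A b) (basic_solution A b K) (basic_solution A b L) \<longleftrightarrow>
    K \<noteq> L \<and> det (gram (case_option (basic_solution A b K - basic_solution A b L) (($) A))
      (insert None (Some ` (K \<inter> L)))) \<noteq> 0"
proof -
  have "basic_solution A b K = basic_solution A b L \<longleftrightarrow> K = L"
    using assms by (metis vertex_rows_iff)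
  with assms show ?thesis
    by (auto simp: poly_adjacent_iff vertex_rows_iff det_gram_nonzero_iff)
qed

text \<open>Farkas' lemma: a finitely generated cone is closed, so an objective outside it is
  separated by some \<open>z\<close>, and \<open>- z\<close> is then a feasible direction that
  improves the objective.\<close>

lemma maximizer_iff_cone:
  fixes A :: "real^'d^'n"
  assumes u: "u \<in> polyhedron_of A b"
  shows "(\<forall>x\<in>polyhedron_of A b. c \<bullet> x \<le> c \<bullet> u) \<longleftrightarrow>
    (\<exists>l. (\<forall>i. 0 \<le> l i) \<and> c = (\<Sum>i\<in>tight_rows A b u. l i *\<^sub>R A $ i))"
proof
  define K where "K = tight_rows A b u"
  assume max: "\<forall>x\<in>polyhedron_of A b. c \<bullet> x \<le> c \<bullet> u"
  let ?C = "convex_cone hull (($) A ` K)"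
  have "c \<in> ?C"
  proof (rule ccontr)
    assume "c \<notin> ?C"
    moreover have "closed ?C" by (intro polyhedron_imp_closed polyhedron_convex_cone_hull) simp
    moreover have "convex ?C" by (rule convex_convex_cone_hull)
    ultimately obtain z \<beta> where z: "z \<bullet> c < \<beta>" "\<And>x. x \<in> ?C \<Longrightarrow> \<beta> < z \<bullet> x"
      using separating_hyperplane_closed_point[of ?C c] by blast
    have "0 \<in> ?C" by (rule convex_cone_hull_contains_0)
    with z(2)[of 0] have "\<beta> < 0" by simp
    have nonneg: "0 \<le> z \<bullet> A $ i" if "i \<in> K" for i
    proof (rule ccontr)
      assume neg: "\<not> 0 \<le> z \<bullet> A $ i"
      \<comment> \<open>Both numbers are negative, so this is a nonnegative multiple of the row; its
        product with \<open>z\<close> is exactly \<open>\<beta>\<close>, against strict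
        separation.\<close>
      have "(\<beta> / (z \<bullet> A $ i)) *\<^sub>R A $ i \<in> ?C"
        using that neg \<open>\<beta> < 0\<close> by (intro convex_cone_hull_mul hull_inc) (auto simp: zero_le_divide_iff)
      with z(2) have "\<beta> < z \<bullet> ((\<beta> / (z \<bullet> A $ i)) *\<^sub>R A $ i)" by blast
      with neg show False by simp
    qed
    have "\<forall>\<^sub>F t in at_right 0. t > 0 \<and> u + t *\<^sub>R (- z) \<in> polyhedron_of A b"
      using nonneg by (intro eventually_conj feasible_direction u)
        (auto simp: eventually_at_right_less K_def inner_commute)
    then obtain t where t: "t > 0" "u + t *\<^sub>R (- z) \<in> polyhedron_of A b"
      using eventually_happens trivial_limit_at_right_real by blast
    with max have "c \<bullet> (u + t *\<^sub>R (- z)) \<le> c \<bullet> u" by blast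
    with t have "0 \<le> c \<bullet> z" by (simp add: inner_diff_right zero_le_mult_iff)
    then have "0 \<le> z \<bullet> c" by (simp add: inner_commute)
    with z \<open>\<beta> < 0\<close> show False by simp
  qed
  moreover have "?C \<subseteq> {y. \<exists>l. (\<forall>i. 0 \<le> l i) \<and> y = (\<Sum>i\<in>K. l i *\<^sub>R A $ i)}" (is "_ \<subseteq> ?S")
  proof (rule hull_minimal)
    show "($) A ` K \<subseteq> ?S"
    proof clarify
      fix k assume k: "k \<in> K"
      have "A $ k = (\<Sum>i\<in>K. (if i = k then 1 else 0) *\<^sub>R A $ i)"
        using k by (simp add: if_distrib[of "\<lambda>s. s *\<^sub>R _"] sum.delta cong: if_cong)
      then show "\<exists>l. (\<forall>i. 0 \<le> l i) \<and> A $ k = (\<Sum>i\<in>K. l i *\<^sub>R A $ i)"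
        by (intro exI[of _ "\<lambda>i. if i = k then 1 else 0"]) auto
    qed
    show "convex_cone ?S"
      unfolding convex_cone_iff
    proof (intro conjI ballI allI impI)
      show "0 \<in> ?S" by (auto intro!: exI[of _ "\<lambda>_. 0"])
      fix x assume x: "x \<in> ?S"
      then obtain l where l: "\<forall>i. 0 \<le> l i" "x = (\<Sum>i\<in>K. l i *\<^sub>R A $ i)" by auto
      { fix y assume "y \<in> ?S"
        then obtain m where m: "\<forall>i. 0 \<le> m i" "y = (\<Sum>i\<in>K. m i *\<^sub>R A $ i)" by auto
        show "x + y \<in> ?S" using l m
          by (auto intro!: exI[of _ "\<lambda>i. l i + m i"] simp: scaleR_add_left sum.distrib)
      }
      { fix s :: real assume "0 \<le> s"
        then show "s *\<^sub>R x \<in> ?S" using l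
          by (auto intro!: exI[of _ "\<lambda>i. s * l i"] simp: scaleR_sum_right)
      }
    qed
  qed
  ultimately show "\<exists>l. (\<forall>i. 0 \<le> l i) \<and> c = (\<Sum>i\<in>tight_rows A b u. l i *\<^sub>R A $ i)"
    by (auto simp: K_def)
next
  assume "\<exists>l. (\<forall>i. 0 \<le> l i) \<and> c = (\<Sum>i\<in>tight_rows A b u. l i *\<^sub>R A $ i)"
  then obtain l where l: "\<And>i. 0 \<le> l i" "c = (\<Sum>i\<in>tight_rows A b u. l i *\<^sub>R A $ i)" by auto
  show "\<forall>x\<in>polyhedron_of A b. c \<bullet> x \<le> c \<bullet> u"
  proof
    fix x assume x: "x \<in> polyhedron_of A b"
    show "c \<bullet> x \<le> c \<bullet> u"
      unfolding l(2) inner_sum_left inner_scaleR_left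
      using l(1) x by (intro sum_mono mult_left_mono) (auto simp: tight_rows_def polyhedron_of_iff)
  qed
qed

text \<open>By Farkas' lemma this says that some nonzero objective is maximal at one vertex and minimal at another,
  with the quantifier over objectives turned into a projection along multipliers.\<close>

definition opposite_cones :: "real^'d^'n \<Rightarrow> 'n set \<Rightarrow> 'n set \<Rightarrow> bool" where
  "opposite_cones A K L \<longleftrightarrow> (\<exists>l m :: real^'n. (\<forall>i. 0 \<le> l $ i) \<and> (\<forall>i. 0 \<le> m $ i) \<and>
     norm (\<Sum>i\<in>K. l $ i *\<^sub>R A $ i) = 1 \<and> (\<Sum>i\<in>K. l $ i *\<^sub>R A $ i) + (\<Sum>i\<in>L. m $ i *\<^sub>R A $ i) = 0)"

text \<open>Farkas' lemma is applied to \<open>c\<close> at \<open>u\<close> and to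
  \<open>- c\<close> at \<open>v\<close>. Dividing the multipliers by \<open>norm c\<close> replaces
  the open condition \<open>c \<noteq> 0\<close> by a closed one, as the projection argument
  requires.\<close>

lemma opposite_cones_iff:
  fixes A :: "real^'d^'n"
  assumes "u \<in> polyhedron_of A b" "v \<in> polyhedron_of A b"
  shows "opposite_cones A (tight_rows A b u) (tight_rows A b v) \<longleftrightarrow>
    (\<exists>c. c \<noteq> 0 \<and> (\<forall>x\<in>polyhedron_of A b. c \<bullet> x \<le> c \<bullet> u) \<and> (\<forall>x\<in>polyhedron_of A b. c \<bullet> v \<le> c \<bullet> x))"
    (is "?L \<longleftrightarrow> ?R")
proof
  let ?P = "polyhedron_of A b" and ?s = "\<lambda>u l. \<Sum>i\<in>tight_rows A b u. l i *\<^sub>R A $ i"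
  have neg: "(\<forall>x\<in>?P. c \<bullet> v \<le> c \<bullet> x) \<longleftrightarrow> (\<exists>l. (\<forall>i. 0 \<le> l i) \<and> - c = ?s v l)" for c
    using maximizer_iff_cone[OF assms(2), of "- c"] by simp
  {
    assume ?L
    then obtain l m :: "real^'n" where lm: "\<forall>i. 0 \<le> l $ i" "\<forall>i. 0 \<le> m $ i"
      "norm (?s u (($) l)) = 1" "?s u (($) l) + ?s v (($) m) = 0"
      by (auto simp: opposite_cones_def)
    have "- ?s u (($) l) = ?s v (($) m)" by (rule minus_unique[OF lm(4)])
    with lm show ?R
      by (intro exI[of _ "?s u (($) l)"]) (auto simp: maximizer_iff_cone[OF assms(1)] neg)
  next
    assume ?R
    then obtain c l m where c: "c \<noteq> 0" and lm: "\<forall>i. 0 \<le> l i" "\<forall>i. 0 \<le> m i" "c = ?s u l" "- c = ?s v m"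
      by (auto simp: maximizer_iff_cone[OF assms(1)] neg)
    have scale: "?s x (\<lambda>i. h i / k) = (1 / k) *\<^sub>R ?s x h" for x h k
      by (simp add: scaleR_sum_right)
    have "?s u (\<lambda>i. l i / norm c) = (1 / norm c) *\<^sub>R c"
      "?s v (\<lambda>i. m i / norm c) = (1 / norm c) *\<^sub>R (- c)"
      unfolding scale by (simp_all only: lm(3,4)[symmetric])
    then show ?L
      unfolding opposite_cones_def using c lm(1,2)
      by (intro exI[of _ "\<chi> i. l i / norm c"] exI[of _ "\<chi> i. m i / norm c"]) simp
  }
qed

section \<open>Distance and diameter bounds as countable conditions on walks\<close>

lemma comb_dist_ge_iff: "enat N \<le> comb_dist P u v \<longleftrightarrow> (\<forall>k. poly_walk P u v k \<longrightarrow> N \<le> k)"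
  by (auto simp: comb_dist_def le_INF_iff)

text \<open>For \<open>N = Suc m\<close> the bound says \<open>m < comb_diam P\<close>, which a
  single pair must witness. The disjunct \<open>N = 0\<close> covers polyhedra without vertices,
  where the supremum is 0.\<close>

lemma comb_diam_ge_iff:
  "enat N \<le> comb_diam P \<longleftrightarrow>
    N = 0 \<or> (\<exists>u\<in>poly_vertices P. \<exists>v\<in>poly_vertices P. enat N \<le> comb_dist P u v)"
proof (cases N)
  case (Suc m)
  show ?thesis
    unfolding Suc Suc_ile_eq comb_diam_def less_SUP_iff by simp
qed (simp add: zero_enat_def[symmetric])

lemma ereal_le_ereal_of_enat_iff: "ereal x \<le> ereal_of_enat k \<longleftrightarrow> enat (nat \<lceil>x\<rceil>) \<le> k"
  by (cases k) (auto simp: nat_le_iff ceiling_le_iff)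

lemma poly_walk_0: "poly_walk P u v 0 \<longleftrightarrow> u = v"
  by (auto simp: poly_walk_def)

lemma poly_walk_iff_relpow: "poly_walk P u v k \<longleftrightarrow> (u, v) \<in> {(x, y). poly_adjacent P x y} ^^ k"
  by (simp add: poly_walk_def relpow_fun_conv)

lemma poly_walk_Suc: "poly_walk P u v (Suc k) \<longleftrightarrow> (\<exists>w. poly_walk P u w k \<and> poly_adjacent P w v)"
  by (auto simp: poly_walk_iff_relpow)

subsection \<open>Measurability\<close>

lemma borel_measurable_det:
  fixes G :: "'a \<Rightarrow> real^'d^'d"
  assumes "\<And>i j. (\<lambda>\<omega>. G \<omega> $ i $ j) \<in> borel_measurable M"
  shows "(\<lambda>\<omega>. det (G \<omega>)) \<in> borel_measurable M"
  unfolding det_def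
  by (intro borel_measurable_sum borel_measurable_times borel_measurable_const borel_measurable_prod assms)

lemma borel_measurable_det_gram:
  fixes f :: "'a \<Rightarrow> 'i \<Rightarrow> real^'d"
  assumes "\<And>i k. i \<in> I \<Longrightarrow> (\<lambda>\<omega>. f \<omega> i $ k) \<in> borel_measurable M"
  shows "(\<lambda>\<omega>. det (gram (f \<omega>) I)) \<in> borel_measurable M"
  by (rule borel_measurable_det)
    (auto simp: gram_def intro!: borel_measurable_sum borel_measurable_times assms)

text \<open>Projecting a closed set along a compact factor gives a closed set; the box for the
  multipliers supplies the compactness.\<close>

lemma closed_opposite_cones_bounded:
  fixes K L :: "'n::finite set" and r :: real
  shows "closed {A :: real^'d^'n. \<exists>p :: (real^'n) \<times> (real^'n). p \<in> cbox 0 (\<chi> i. r) \<times> cbox 0 (\<chi> i. r) \<and>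
    norm (\<Sum>i\<in>K. fst p $ i *\<^sub>R A $ i) = 1 \<and>
    (\<Sum>i\<in>K. fst p $ i *\<^sub>R A $ i) + (\<Sum>i\<in>L. snd p $ i *\<^sub>R A $ i) = 0}"
proof -
  let ?T = "{(p, A). norm (\<Sum>i\<in>K. fst p $ i *\<^sub>R A $ i) = 1 \<and>
    (\<Sum>i\<in>K. fst p $ i *\<^sub>R A $ i) + (\<Sum>i\<in>L. snd p $ i *\<^sub>R A $ i) = 0} :: (((real^'n) \<times> (real^'n)) \<times> (real^'d^'n)) set"
  have "closed ?T"
    unfolding case_prod_beta by (intro closed_Collect_conj closed_Collect_eq continuous_intros)
  from closed_compact_projection[OF compact_Times[OF compact_cbox compact_cbox] this]
  show ?thesis by simp
qed

lemma opposite_cones_bounded: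
  fixes A :: "real^'d^'n"
  shows "opposite_cones A K L \<longleftrightarrow> (\<exists>r::nat. \<exists>p. p \<in> cbox 0 (\<chi> i. real r) \<times> cbox 0 (\<chi> i. real r) \<and>
    norm (\<Sum>i\<in>K. fst p $ i *\<^sub>R A $ i) = 1 \<and>
    (\<Sum>i\<in>K. fst p $ i *\<^sub>R A $ i) + (\<Sum>i\<in>L. snd p $ i *\<^sub>R A $ i) = 0)"
proof
  assume "opposite_cones A K L"
  then obtain l m :: "real^'n" where lm: "\<forall>i. 0 \<le> l $ i" "\<forall>i. 0 \<le> m $ i"
    "norm (\<Sum>i\<in>K. l $ i *\<^sub>R A $ i) = 1" "(\<Sum>i\<in>K. l $ i *\<^sub>R A $ i) + (\<Sum>i\<in>L. m $ i *\<^sub>R A $ i) = 0"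
    by (auto simp: opposite_cones_def)
  obtain r :: nat where r: "max (norm l) (norm m) \<le> real r" using real_arch_simple by blast
  have "x $ i \<le> real r" if "norm x \<le> real r" for x :: "real^'n" and i
    using component_le_norm_cart[of x i] that by linarith
  with lm r show "\<exists>r::nat. \<exists>p. p \<in> cbox 0 (\<chi> i. real r) \<times> cbox 0 (\<chi> i. real r) \<and>
    norm (\<Sum>i\<in>K. fst p $ i *\<^sub>R A $ i) = 1 \<and>
    (\<Sum>i\<in>K. fst p $ i *\<^sub>R A $ i) + (\<Sum>i\<in>L. snd p $ i *\<^sub>R A $ i) = 0"
    by (intro exI[of _ r] exI[of _ "(l, m)"]) (auto simp: mem_box_cart)
next
  assume "\<exists>r::nat. \<exists>p. p \<in> cbox 0 (\<chi> i. real r) \<times> cbox 0 (\<chi> i. real r) \<and>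
    norm (\<Sum>i\<in>K. fst p $ i *\<^sub>R A $ i) = 1 \<and>
    (\<Sum>i\<in>K. fst p $ i *\<^sub>R A $ i) + (\<Sum>i\<in>L. snd p $ i *\<^sub>R A $ i) = 0"
  then obtain r p where "p \<in> cbox 0 (\<chi> i. real r) \<times> cbox 0 (\<chi> i. real r)"
    "norm (\<Sum>i\<in>K. fst p $ i *\<^sub>R A $ i) = 1"
    "(\<Sum>i\<in>K. fst p $ i *\<^sub>R A $ i) + (\<Sum>i\<in>L. snd p $ i *\<^sub>R A $ i) = 0" by blast
  then show "opposite_cones A K L"
    unfolding opposite_cones_def by (intro exI[of _ "fst p"] exI[of _ "snd p"]) (auto simp: mem_box_cart)
qed

context
  fixes M :: "'a measure" and A :: "'a \<Rightarrow> real^'d^'n" and b :: "'a \<Rightarrow> real^'n"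
  assumes meas_A [measurable]: "\<And>i j. (\<lambda>\<omega>. A \<omega> $ i $ j) \<in> borel_measurable M"
    and meas_b [measurable]: "\<And>i. (\<lambda>\<omega>. b \<omega> $ i) \<in> borel_measurable M"
begin

lemma measurable_basic_solution [measurable]:
  "(\<lambda>\<omega>. basic_solution (A \<omega>) (b \<omega>) K $ k) \<in> borel_measurable M"
proof -
  have "(\<lambda>\<omega>. det (\<chi> i j. if j = k then \<Sum>r\<in>K. b \<omega> $ r * A \<omega> $ r $ i
      else gram (($) (A \<omega>)) K $ i $ j)) \<in> borel_measurable M"
  proof (rule borel_measurable_det)
    show "(\<lambda>\<omega>. (\<chi> i j. if j = k then \<Sum>r\<in>K. b \<omega> $ r * A \<omega> $ r $ i
      else gram (($) (A \<omega>)) K $ i $ j) $ i $ j) \<in> borel_measurable M" for i j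
      by (cases "j = k") (simp_all add: gram_def)
  qed
  moreover have "(\<lambda>\<omega>. det (gram (($) (A \<omega>)) K)) \<in> borel_measurable M"
    by (rule borel_measurable_det_gram) simp
  ultimately show ?thesis
    by (simp add: basic_solution_def)
qed

lemma pred_vertex_rows [measurable]: "Measurable.pred M (\<lambda>\<omega>. vertex_rows (A \<omega>) (b \<omega>) K)"
proof -
  have [measurable]: "(\<lambda>\<omega>. det (gram (($) (A \<omega>)) K)) \<in> borel_measurable M"
    by (rule borel_measurable_det_gram) simp
  have [measurable]: "(\<lambda>\<omega>. A \<omega> $ i \<bullet> basic_solution (A \<omega>) (b \<omega>) K) \<in> borel_measurable M" for i
    unfolding inner_vec_def by measurable
  have "Measurable.pred M (\<lambda>\<omega>. if i \<in> K then A \<omega> $ i \<bullet> basic_solution (A \<omega>) (b \<omega>) K = b \<omega> $ i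
          else A \<omega> $ i \<bullet> basic_solution (A \<omega>) (b \<omega>) K < b \<omega> $ i)" for i
    by (cases "i \<in> K") simp_all
  then show ?thesis unfolding vertex_rows_def by measurable
qed

lemma pred_poly_adjacent:
  "Measurable.pred M (\<lambda>\<omega>. vertex_rows (A \<omega>) (b \<omega>) K \<and> vertex_rows (A \<omega>) (b \<omega>) L \<and>
    poly_adjacent (polyhedron_of (A \<omega>) (b \<omega>)) (basic_solution (A \<omega>) (b \<omega>) K) (basic_solution (A \<omega>) (b \<omega>) L))"
proof -
  have [measurable]: "(\<lambda>\<omega>. det (gram (case_option (basic_solution (A \<omega>) (b \<omega>) K - basic_solution (A \<omega>) (b \<omega>) L)
      (($) (A \<omega>))) (insert None (Some ` (K \<inter> L))))) \<in> borel_measurable M"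
    by (rule borel_measurable_det_gram) auto
  have "Measurable.pred M (\<lambda>\<omega>. vertex_rows (A \<omega>) (b \<omega>) K \<and> vertex_rows (A \<omega>) (b \<omega>) L \<and>
    K \<noteq> L \<and> det (gram (case_option (basic_solution (A \<omega>) (b \<omega>) K - basic_solution (A \<omega>) (b \<omega>) L) (($) (A \<omega>)))
      (insert None (Some ` (K \<inter> L)))) \<noteq> 0)"
    by measurable
  then show ?thesis by (simp add: poly_adjacent_basic_solution cong: conj_cong)
qed

text \<open>Induction on the length: the vertex before last is one of finitely many basic solutions,
  so extending a walk is a finite disjunction.\<close>

lemma pred_poly_walk:
  "Measurable.pred M (\<lambda>\<omega>. vertex_rows (A \<omega>) (b \<omega>) K \<and> vertex_rows (A \<omega>) (b \<omega>) L \<and>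
    poly_walk (polyhedron_of (A \<omega>) (b \<omega>)) (basic_solution (A \<omega>) (b \<omega>) K) (basic_solution (A \<omega>) (b \<omega>) L) k)"
proof (induction k arbitrary: L)
  case 0
  have [measurable]: "Measurable.pred M (\<lambda>\<omega>. basic_solution (A \<omega>) (b \<omega>) K = basic_solution (A \<omega>) (b \<omega>) L)"
    unfolding vec_eq_iff by measurable
  show ?case unfolding poly_walk_0 by measurable
next
  case (Suc k)
  note [measurable] = Suc.IH pred_poly_adjacent
  let ?w = "\<lambda>\<omega>. vertex_rows (A \<omega>) (b \<omega>)" and ?x = "\<lambda>\<omega>. basic_solution (A \<omega>) (b \<omega>)"
    and ?P = "\<lambda>\<omega>. polyhedron_of (A \<omega>) (b \<omega>)"
  have eq: "?w \<omega> K \<and> ?w \<omega> L \<and> poly_walk (?P \<omega>) (?x \<omega> K) (?x \<omega> L) (Suc k) \<longleftrightarrow>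
      (\<exists>J. (?w \<omega> K \<and> ?w \<omega> J \<and> poly_walk (?P \<omega>) (?x \<omega> K) (?x \<omega> J) k) \<and>
           (?w \<omega> J \<and> ?w \<omega> L \<and> poly_adjacent (?P \<omega>) (?x \<omega> J) (?x \<omega> L)))" for \<omega>
  proof
    assume L: "?w \<omega> K \<and> ?w \<omega> L \<and> poly_walk (?P \<omega>) (?x \<omega> K) (?x \<omega> L) (Suc k)"
    then obtain y where y: "poly_walk (?P \<omega>) (?x \<omega> K) y k" "poly_adjacent (?P \<omega>) y (?x \<omega> L)"
      by (auto simp: poly_walk_Suc)
    then obtain J where "y = ?x \<omega> J" "?w \<omega> J" by (auto simp: poly_adjacent_def poly_vertices_eq)
    with L y show "\<exists>J. (?w \<omega> K \<and> ?w \<omega> J \<and> poly_walk (?P \<omega>) (?x \<omega> K) (?x \<omega> J) k) \<and>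
           (?w \<omega> J \<and> ?w \<omega> L \<and> poly_adjacent (?P \<omega>) (?x \<omega> J) (?x \<omega> L))" by blast
  qed (auto simp: poly_walk_Suc)
  show ?case unfolding eq by measurable
qed

lemma pred_comb_dist_ge:
  "Measurable.pred M (\<lambda>\<omega>. vertex_rows (A \<omega>) (b \<omega>) K \<and> vertex_rows (A \<omega>) (b \<omega>) L \<and>
    enat N \<le> comb_dist (polyhedron_of (A \<omega>) (b \<omega>)) (basic_solution (A \<omega>) (b \<omega>) K) (basic_solution (A \<omega>) (b \<omega>) L))"
proof -
  note [measurable] = pred_poly_walk
  \<comment> \<open>The guards recur under the quantifier because walks are known to be measurable
    only together with them.\<close>
  have "Measurable.pred M (\<lambda>\<omega>. vertex_rows (A \<omega>) (b \<omega>) K \<and> vertex_rows (A \<omega>) (b \<omega>) L \<and>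
     (\<forall>k. (vertex_rows (A \<omega>) (b \<omega>) K \<and> vertex_rows (A \<omega>) (b \<omega>) L \<and>
    poly_walk (polyhedron_of (A \<omega>) (b \<omega>)) (basic_solution (A \<omega>) (b \<omega>) K) (basic_solution (A \<omega>) (b \<omega>) L) k)
     \<longrightarrow> N \<le> k))"
    by measurable
  then show ?thesis by (simp add: comb_dist_ge_iff cong: conj_cong)
qed

lemma sets_comb_diam_ge:
  "{\<omega> \<in> space M. ereal B \<le> ereal_of_enat (comb_diam (polyhedron_of (A \<omega>) (b \<omega>)))} \<in> sets M"
proof -
  note [measurable] = pred_comb_dist_ge
  let ?N = "nat \<lceil>B\<rceil>"
  have "Measurable.pred M (\<lambda>\<omega>. ?N = 0 \<or> (\<exists>K L. vertex_rows (A \<omega>) (b \<omega>) K \<and> vertex_rows (A \<omega>) (b \<omega>) L \<and>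
    enat ?N \<le> comb_dist (polyhedron_of (A \<omega>) (b \<omega>)) (basic_solution (A \<omega>) (b \<omega>) K) (basic_solution (A \<omega>) (b \<omega>) L)))"
    by measurable
  also have "(\<lambda>\<omega>. ?N = 0 \<or> (\<exists>K L. vertex_rows (A \<omega>) (b \<omega>) K \<and> vertex_rows (A \<omega>) (b \<omega>) L \<and>
      enat ?N \<le> comb_dist (polyhedron_of (A \<omega>) (b \<omega>)) (basic_solution (A \<omega>) (b \<omega>) K) (basic_solution (A \<omega>) (b \<omega>) L)))
    = (\<lambda>\<omega>. ereal B \<le> ereal_of_enat (comb_diam (polyhedron_of (A \<omega>) (b \<omega>))))"
    unfolding ereal_le_ereal_of_enat_iff comb_diam_ge_iff poly_vertices_eq by (intro ext) blast
  finally show ?thesis by (simp add: pred_def)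
qed

lemma pred_opposite_cones [measurable]: "Measurable.pred M (\<lambda>\<omega>. opposite_cones (A \<omega>) K L)"
proof -
  have [measurable]: "A \<in> borel_measurable M"
    by (subst borel_measurable_euclidean_space) (auto simp: Basis_vec_def inner_axis)
  have "Measurable.pred M (\<lambda>\<omega>. \<exists>p. p \<in> cbox 0 (\<chi> i. real r) \<times> cbox 0 (\<chi> i. real r) \<and>
    norm (\<Sum>i\<in>K. fst p $ i *\<^sub>R A \<omega> $ i) = 1 \<and>
    (\<Sum>i\<in>K. fst p $ i *\<^sub>R A \<omega> $ i) + (\<Sum>i\<in>L. snd p $ i *\<^sub>R A \<omega> $ i) = 0)" for r :: nat
    using borel_closed[OF closed_opposite_cones_bounded[of "real r" K L]]
    by (intro measurable_compose[OF \<open>A \<in> borel_measurable M\<close>]) (simp add: pred_def)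
  then show ?thesis unfolding opposite_cones_bounded by measurable
qed

text \<open>The objective occurs only in the premise, so the universal quantifier over
  \<open>c\<close> becomes an existential one there, which is \<open>opposite_cones\<close>.\<close>

lemma sets_comb_dist_optimal_ge:
  "{\<omega> \<in> space M. \<forall>c. c \<noteq> 0 \<longrightarrow>
      (\<forall>u v. let P = polyhedron_of (A \<omega>) (b \<omega>) in
         u \<in> poly_vertices P \<and> (\<forall>x\<in>P. c \<bullet> x \<le> c \<bullet> u) \<and>
         v \<in> poly_vertices P \<and> (\<forall>x\<in>P. c \<bullet> v \<le> c \<bullet> x) \<longrightarrow>
         ereal B \<le> ereal_of_enat (comb_dist P u v))} \<in> sets M"
proof -
  note [measurable] = pred_comb_dist_ge
  let ?N = "nat \<lceil>B\<rceil>"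
  let ?w = "\<lambda>\<omega>. vertex_rows (A \<omega>) (b \<omega>)" and ?x = "\<lambda>\<omega>. basic_solution (A \<omega>) (b \<omega>)"
    and ?P = "\<lambda>\<omega>. polyhedron_of (A \<omega>) (b \<omega>)"
  have "Measurable.pred M (\<lambda>\<omega>. \<forall>K L. ?w \<omega> K \<and> ?w \<omega> L \<and> opposite_cones (A \<omega>) K L \<longrightarrow>
      ?w \<omega> K \<and> ?w \<omega> L \<and> enat ?N \<le> comb_dist (?P \<omega>) (?x \<omega> K) (?x \<omega> L))"
    by measurable
  also have "(\<lambda>\<omega>. \<forall>K L. ?w \<omega> K \<and> ?w \<omega> L \<and> opposite_cones (A \<omega>) K L \<longrightarrow>
      ?w \<omega> K \<and> ?w \<omega> L \<and> enat ?N \<le> comb_dist (?P \<omega>) (?x \<omega> K) (?x \<omega> L))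
    = (\<lambda>\<omega>. \<forall>c. c \<noteq> 0 \<longrightarrow>
      (\<forall>u v. let P = polyhedron_of (A \<omega>) (b \<omega>) in
         u \<in> poly_vertices P \<and> (\<forall>x\<in>P. c \<bullet> x \<le> c \<bullet> u) \<and>
         v \<in> poly_vertices P \<and> (\<forall>x\<in>P. c \<bullet> v \<le> c \<bullet> x) \<longrightarrow>
         ereal B \<le> ereal_of_enat (comb_dist P u v)))" (is "?F = ?G")
  proof (rule ext)
    fix \<omega>
    have cones: "opposite_cones (A \<omega>) K L \<longleftrightarrow> (\<exists>c. c \<noteq> 0 \<and>
        (\<forall>x\<in>?P \<omega>. c \<bullet> x \<le> c \<bullet> ?x \<omega> K) \<and> (\<forall>x\<in>?P \<omega>. c \<bullet> ?x \<omega> L \<le> c \<bullet> x))"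
      if "?w \<omega> K" "?w \<omega> L" for K L
      using that opposite_cones_iff[of "?x \<omega> K" "A \<omega>" "b \<omega>" "?x \<omega> L"]
      by (simp add: vertex_rows_iff poly_vertices_iff)
    have "?G \<omega> \<longleftrightarrow> (\<forall>K L. ?w \<omega> K \<longrightarrow> ?w \<omega> L \<longrightarrow> (\<exists>c. c \<noteq> 0 \<and>
        (\<forall>x\<in>?P \<omega>. c \<bullet> x \<le> c \<bullet> ?x \<omega> K) \<and> (\<forall>x\<in>?P \<omega>. c \<bullet> ?x \<omega> L \<le> c \<bullet> x)) \<longrightarrow>
        enat ?N \<le> comb_dist (?P \<omega>) (?x \<omega> K) (?x \<omega> L))"
      unfolding Let_def ereal_le_ereal_of_enat_iff poly_vertices_eq by blast
    also have "\<dots> \<longleftrightarrow> (\<forall>K L. ?w \<omega> K \<longrightarrow> ?w \<omega> L \<longrightarrow> opposite_cones (A \<omega>) K L \<longrightarrow>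
        enat ?N \<le> comb_dist (?P \<omega>) (?x \<omega> K) (?x \<omega> L))"
      by (intro all_cong1 imp_cong refl cones[symmetric])
    also have "\<dots> \<longleftrightarrow> ?F \<omega>" by blast
    finally show "?F \<omega> = ?G \<omega>" by (rule sym)
  qed
  finally show ?thesis by (simp add: pred_def)
qed

end

subsection \<open>Gaussian estimates\<close>

definition gauss_mean :: "real^'d^'n \<Rightarrow> real^'n \<Rightarrow> ('n \<times> 'd) + 'n \<Rightarrow> real" where
  "gauss_mean A b k = (case k of Inl (i, j) \<Rightarrow> A $ i $ j | Inr i \<Rightarrow> b $ i)"

lemma gauss_model_eq:
  "gauss_model A b \<sigma> = PiM UNIV (\<lambda>k. density lborel (normal_density (gauss_mean A b k) \<sigma>))"
  by (simp add: gauss_model_def gauss_mean_def)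

lemma sets_gauss_model: "sets (gauss_model A b \<sigma>) = sets (PiM UNIV (\<lambda>_. borel))"
  unfolding gauss_model_eq by (intro sets_PiM_cong) auto

lemma space_gauss_model: "space (gauss_model A b \<sigma>) = UNIV"
  by (simp add: gauss_model_eq space_PiM)

lemma measurable_gauss_component [measurable]:
  "(\<lambda>\<omega>. \<omega> k) \<in> borel_measurable (gauss_model A b \<sigma>)"
  unfolding measurable_cong_sets[OF sets_gauss_model refl] by measurable

lemma prob_space_gauss_model:
  assumes "\<sigma> > 0"
  shows "prob_space (gauss_model A b \<sigma>)"
  unfolding gauss_model_eq by (intro prob_space_PiM prob_space_normal_density assms)

text \<open>As \<open>3/8 = 1/2 - 1/8\<close>, the factor turns the density into one of standard
  deviation \<open>2 * \<sigma>\<close>, up to the ratio 2 of the normalizing constants.\<close>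

lemma nn_integral_exp_square_normal:
  assumes s: "\<sigma> > 0"
  shows "(\<integral>\<^sup>+y. ennreal (exp (3 * (y - \<mu>)\<^sup>2 / (8 * \<sigma>\<^sup>2))) \<partial>density lborel (normal_density \<mu> \<sigma>)) = 2"
proof -
  have eq: "normal_density \<mu> \<sigma> y * exp (3 * (y - \<mu>)\<^sup>2 / (8 * \<sigma>\<^sup>2)) = 2 * normal_density \<mu> (2 * \<sigma>) y" for y
  proof -
    have "sqrt (2 * pi * (2 * \<sigma>)\<^sup>2) = 2 * sqrt (2 * pi * \<sigma>\<^sup>2)"
    proof -
      have "2 * pi * (2 * \<sigma>)\<^sup>2 = 2\<^sup>2 * (2 * pi * \<sigma>\<^sup>2)" by (simp add: power_mult_distrib)
      then show ?thesis by (simp only: real_sqrt_mult[of "2\<^sup>2"] real_sqrt_abs abs_numeral)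
    qed
    moreover have "exp (- (y - \<mu>)\<^sup>2 / (2 * \<sigma>\<^sup>2)) * exp (3 * (y - \<mu>)\<^sup>2 / (8 * \<sigma>\<^sup>2)) = exp (- (y - \<mu>)\<^sup>2 / (2 * (2 * \<sigma>)\<^sup>2))"
      unfolding exp_add[symmetric] using s by (simp add: field_simps)
    ultimately show ?thesis by (simp add: normal_density_def)
  qed
  have "(\<integral>\<^sup>+y. ennreal (exp (3 * (y - \<mu>)\<^sup>2 / (8 * \<sigma>\<^sup>2))) \<partial>density lborel (normal_density \<mu> \<sigma>))
      = (\<integral>\<^sup>+y. ennreal (2 * normal_density \<mu> (2 * \<sigma>) y) \<partial>lborel)"
    by (subst nn_integral_density) (simp_all add: ennreal_mult'[symmetric] eq)
  also have "\<dots> = ennreal (\<integral>y. 2 * normal_density \<mu> (2 * \<sigma>) y \<partial>lborel)"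
    using s by (intro nn_integral_eq_integral) auto
  finally show ?thesis using s by simp
qed

text \<open>Exponential Markov inequality: the \<open>d + 1\<close> entries of a row are independent
  and each contributes a factor 2 to the moment.\<close>

lemma prob_gauss_row_noise_ge:
  fixes A0 :: "real^'d^'n"
  assumes s: "\<sigma> > 0"
  shows "measure (gauss_model A0 b0 \<sigma>) {\<omega>. t\<^sup>2 \<le> (norm (mat_of \<omega> $ i - A0 $ i))\<^sup>2 + (vec_of \<omega> $ i - b0 $ i)\<^sup>2}
    \<le> 2 ^ (CARD('d) + 1) * exp (- (3 * t\<^sup>2 / (8 * \<sigma>\<^sup>2)))"
proof -
  let ?M = "gauss_model A0 b0 \<sigma>" and ?m = "gauss_mean A0 b0"
  let ?D = "\<lambda>k. density lborel (normal_density (?m k) \<sigma>)"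
  interpret prob_space ?M by (rule prob_space_gauss_model[OF s])
  interpret product_sigma_finite ?D
    by (intro product_sigma_finite.intro prob_space_imp_sigma_finite prob_space_normal_density s)
  define R :: "(('n \<times> 'd) + 'n) set" where "R = insert (Inr i) ((\<lambda>j. Inl (i, j)) ` UNIV)"
  define S where "S \<omega> = (norm (mat_of \<omega> $ i - A0 $ i))\<^sup>2 + (vec_of \<omega> $ i - b0 $ i)\<^sup>2" for \<omega>
  have card_R: "card R = CARD('d) + 1"
    unfolding R_def by (subst card_insert_disjoint) (auto simp: card_image inj_on_def)
  have norm2: "(norm x)\<^sup>2 = (\<Sum>j\<in>UNIV. (x $ j)\<^sup>2)" for x :: "real^'d"
    unfolding power2_norm_eq_inner inner_vec_def by (simp add: power2_eq_square)
  have S: "S \<omega> = (\<Sum>k\<in>R. (\<omega> k - ?m k)\<^sup>2)" for \<omega>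
    unfolding R_def S_def
    by (subst sum.insert)
      (auto simp: sum.reindex inj_on_def gauss_mean_def norm2 mat_of_def vec_of_def)
  define c where "c = 3 / (8 * \<sigma>\<^sup>2)"
  have c: "c > 0" using s by (simp add: c_def)
  \<comment> \<open>The value 1 off the row extends the product to all coordinates, as the product
    measure requires.\<close>
  define g where "g k y = (if k \<in> R then ennreal (exp (3 * (y - ?m k)\<^sup>2 / (8 * \<sigma>\<^sup>2))) else 1)" for k y
  have [measurable]: "S \<in> borel_measurable ?M" unfolding S by measurable
  have exp_S: "ennreal (exp (c * S \<omega>)) = (\<Prod>k\<in>UNIV. g k (\<omega> k))" for \<omega>
  proof -
    have "(\<Prod>k\<in>UNIV. g k (\<omega> k)) = (\<Prod>k\<in>R. ennreal (exp (3 * (\<omega> k - ?m k)\<^sup>2 / (8 * \<sigma>\<^sup>2))))"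
      unfolding g_def by (simp add: prod.If_cases)
    also have "\<dots> = ennreal (\<Prod>k\<in>R. exp (3 * (\<omega> k - ?m k)\<^sup>2 / (8 * \<sigma>\<^sup>2)))"
      by (rule prod_ennreal) simp
    also have "(\<Prod>k\<in>R. exp (3 * (\<omega> k - ?m k)\<^sup>2 / (8 * \<sigma>\<^sup>2))) = exp (c * S \<omega>)"
      by (simp add: S exp_sum[symmetric] sum_distrib_left c_def R_def)
    finally show ?thesis by simp
  qed
  have "(\<integral>\<^sup>+\<omega>. ennreal (exp (c * S \<omega>)) \<partial>?M) = (\<Prod>k\<in>UNIV. \<integral>\<^sup>+y. g k y \<partial>?D k)"
    unfolding exp_S gauss_model_eq
    by (rule product_nn_integral_prod) (auto simp: g_def)
  also have "\<dots> = (\<Prod>k\<in>UNIV. if k \<in> R then 2 else 1)"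
  proof (rule prod.cong[OF refl])
    fix k
    interpret D: prob_space "?D k" by (rule prob_space_normal_density[OF s])
    show "(\<integral>\<^sup>+y. g k y \<partial>?D k) = (if k \<in> R then 2 else 1)"
      using nn_integral_exp_square_normal[OF s, of "?m k"] D.emeasure_space_1 by (simp add: g_def)
  qed
  also have "\<dots> = 2 ^ (CARD('d) + 1)"
    by (simp add: prod.If_cases card_R)
  also have "\<dots> = ennreal (2 ^ (CARD('d) + 1))"
    using ennreal_power[of 2 "CARD('d) + 1"] by (simp only: ennreal_numeral zero_le_numeral simp_thms)
  finally have E: "(\<integral>\<^sup>+\<omega>. ennreal (exp (c * S \<omega>)) \<partial>?M) = ennreal (2 ^ (CARD('d) + 1))" .
  have "{\<omega>. t\<^sup>2 \<le> S \<omega>} = {\<omega>\<in>space ?M. 1 \<le> ennreal (exp (- (c * t\<^sup>2))) * ennreal (exp (c * S \<omega>))}"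
  proof -
    have "1 \<le> ennreal (exp (- (c * t\<^sup>2))) * ennreal (exp (c * S \<omega>)) \<longleftrightarrow> t\<^sup>2 \<le> S \<omega>" for \<omega>
    proof -
      have "ennreal (exp (- (c * t\<^sup>2))) * ennreal (exp (c * S \<omega>)) = ennreal (exp (c * (S \<omega> - t\<^sup>2)))"
        by (simp add: ennreal_mult'[symmetric] exp_add[symmetric] algebra_simps)
      then show ?thesis using c by (simp add: zero_le_mult_iff)
    qed
    then show ?thesis by (simp add: space_gauss_model)
  qed
  then have "emeasure ?M {\<omega>. t\<^sup>2 \<le> S \<omega>} \<le> ennreal (exp (- (c * t\<^sup>2))) *
      (\<integral>\<^sup>+\<omega>. ennreal (exp (c * S \<omega>)) * indicator (space ?M) \<omega> \<partial>?M)"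
    using nn_integral_Markov_inequality[of "\<lambda>\<omega>. ennreal (exp (c * S \<omega>))" "space ?M" ?M "ennreal (exp (- (c * t\<^sup>2)))"]
    by simp
  also have "\<dots> = ennreal (exp (- (c * t\<^sup>2))) * ennreal (2 ^ (CARD('d) + 1))"
    by (simp add: space_gauss_model E)
  also have "\<dots> = ennreal (2 ^ (CARD('d) + 1) * exp (- (c * t\<^sup>2)))"
    by (simp add: ennreal_mult'[symmetric] mult.commute)
  finally show ?thesis
    by (simp add: emeasure_eq_measure S_def c_def)
qed

text \<open>By Fubini, coordinate \<open>k\<close> is integrated first: with the others fixed,
  \<open>f\<close> is constant and a single point has no mass.\<close>

lemma null_sets_gauss_coordinate:
  fixes A0 :: "real^'d^'n"
  assumes s: "\<sigma> > 0" and f [measurable]: "f \<in> borel_measurable (gauss_model A0 b0 \<sigma>)"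
    and indep: "\<And>\<omega> y. f (fun_upd \<omega> k y) = f \<omega>"
  shows "{\<omega>. \<omega> k = f \<omega>} \<in> null_sets (gauss_model A0 b0 \<sigma>)"
proof -
  let ?M = "gauss_model A0 b0 \<sigma>" and ?m = "gauss_mean A0 b0"
  let ?D = "\<lambda>k. density lborel (normal_density (?m k) \<sigma>)"
  interpret product_sigma_finite ?D
    by (intro product_sigma_finite.intro prob_space_imp_sigma_finite prob_space_normal_density s)
  have "{\<omega>\<in>space ?M. \<omega> k = f \<omega>} \<in> sets ?M" by measurable
  then have sets: "{\<omega>. \<omega> k = f \<omega>} \<in> sets ?M" by (simp add: space_gauss_model)
  have UNIV: "insert k (UNIV - {k}) = UNIV" by auto
  have "emeasure ?M {\<omega>. \<omega> k = f \<omega>} = (\<integral>\<^sup>+\<omega>. indicator {\<omega>. \<omega> k = f \<omega>} \<omega> \<partial>?M)"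
    using sets by simp
  also have "\<dots> = (\<integral>\<^sup>+\<omega>. indicator {\<omega>. \<omega> k = f \<omega>} \<omega> \<partial>PiM (insert k (UNIV - {k})) ?D)"
    by (simp add: UNIV gauss_model_eq)
  also have "\<dots> = (\<integral>\<^sup>+x. (\<integral>\<^sup>+y. indicator {\<omega>. \<omega> k = f \<omega>} (fun_upd x k y) \<partial>?D k) \<partial>PiM (UNIV - {k}) ?D)"
    using sets by (intro product_nn_integral_insert) (auto simp: UNIV gauss_model_eq)
  also have "\<dots> = (\<integral>\<^sup>+x. (\<integral>\<^sup>+y. indicator {f x} y \<partial>?D k) \<partial>PiM (UNIV - {k}) ?D)"
    by (intro nn_integral_cong) (auto simp: indep indicator_def)
  also have "(\<lambda>x. \<integral>\<^sup>+y. indicator {f x} y \<partial>?D k) = (\<lambda>x. 0)"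
    by (simp add: emeasure_density nn_integral_indicator_singleton)
  finally show ?thesis using sets by (simp add: null_sets_def)
qed

section \<open>Degenerate vertices have probability zero\<close>

lemma basic_solution_cong:
  assumes "\<And>i. i \<in> K \<Longrightarrow> b $ i = b' $ i"
  shows "basic_solution A b K = basic_solution A b' K"
proof -
  have "(\<Sum>r\<in>K. b $ r * A $ r $ i) = (\<Sum>r\<in>K. b' $ r * A $ r $ i)" for i
    using assms by simp
  then show ?thesis by (simp add: basic_solution_def cong: if_cong)
qed

text \<open>More than \<open>d\<close> tight rows are dependent. Dropping one that lies in the span
  of the rest still determines the vertex, so the dropped right-hand side is a function of the other
  data.\<close>

lemma degenerate_vertex_redundant_row:
  fixes A :: "real^'d^'n"
  assumes u: "u \<in> poly_vertices (polyhedron_of A b)" and card: "CARD('d) < card (tight_rows A b u)"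
  obtains i K where "i \<notin> K" "b $ i = A $ i \<bullet> basic_solution A b K"
proof -
  let ?T = "tight_rows A b u"
  obtain i where i: "i \<in> ?T" "A $ i \<in> span (($) A ` (?T - {i}))"
  proof (cases "inj_on (($) A) ?T")
    case True
    then have "card (($) A ` ?T) > DIM(real^'d)" using card by (simp add: card_image)
    then have "dependent (($) A ` ?T)" using independent_bound by (metis not_le)
    then obtain i where "i \<in> ?T" "A $ i \<in> span (($) A ` ?T - {A $ i})"
      by (auto simp: dependent_def)
    moreover have "($) A ` ?T - {A $ i} \<subseteq> ($) A ` (?T - {i})" by auto
    ultimately show ?thesis using that span_mono by blast
  \<comment> \<open>Equal rows collapse in the set of vectors, whose linear dependence would then
    not see the repetition.\<close>
  next
    case False
    then obtain i j where "i \<in> ?T" "j \<in> ?T" "i \<noteq> j" "A $ i = A $ j" by (auto simp: inj_on_def)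
    then show ?thesis by (intro that[of i]) (auto intro!: span_base)
  qed
  have "det (gram (($) A) (?T - {i})) \<noteq> 0"
    unfolding det_gram_nonzero_iff[OF finite]
  proof (intro allI impI)
    fix z assume z: "\<forall>j\<in>?T - {i}. A $ j \<bullet> z = 0"
    have "orthogonal z (A $ i)"
      using z by (intro orthogonal_to_span[OF i(2)]) (auto simp: orthogonal_def inner_commute)
    with z have "\<forall>j\<in>?T. A $ j \<bullet> z = 0" by (auto simp: orthogonal_def inner_commute)
    with u show "z = 0" by (simp add: poly_vertices_iff)
  qed
  then have "u = basic_solution A b (?T - {i})"
    by (rule basic_solution_unique) (auto simp: tight_rows_def)
  with i(1) show ?thesis by (intro that[of i "?T - {i}"]) (auto simp: tight_rows_def)
qed

text \<open>For \<open>i \<notin> K\<close> the prediction \<open>f K i\<close> does not involve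
  \<open>b $ i\<close>, so equality is a null event; there are finitely many pairs
  \<open>(K, i)\<close>.\<close>

lemma null_sets_gauss_degenerate:
  fixes A0 :: "real^'d^'n"
  assumes s: "\<sigma> > 0"
  obtains N where "N \<in> null_sets (gauss_model A0 b0 \<sigma>)"
    "\<And>\<omega> u. \<omega> \<notin> N \<Longrightarrow> u \<in> poly_vertices (polyhedron_of (mat_of \<omega>) (vec_of \<omega>)) \<Longrightarrow>
      card (tight_rows (mat_of \<omega>) (vec_of \<omega>) u) \<le> CARD('d)"
proof -
  let ?M = "gauss_model A0 b0 \<sigma>"
  define f where "f K i \<omega> = mat_of \<omega> $ i \<bullet> basic_solution (mat_of \<omega>) (vec_of \<omega>) K" for K :: "'n set" and i and \<omega> :: "('n \<times> 'd) + 'n \<Rightarrow> real"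
  have [measurable]: "(\<lambda>\<omega>. mat_of \<omega> $ i $ j) \<in> borel_measurable ?M" "(\<lambda>\<omega>. vec_of \<omega> $ i) \<in> borel_measurable ?M" for i j
    by (simp_all add: mat_of_def vec_of_def)
  have "f K i \<in> borel_measurable ?M" for K i
    unfolding f_def inner_vec_def
    by (intro borel_measurable_sum borel_measurable_inner measurable_basic_solution) measurable
  then have null: "{\<omega>. \<omega> (Inr i) = f K i \<omega>} \<in> null_sets ?M" if "i \<notin> K" for K i
  proof (rule null_sets_gauss_coordinate[OF s])
    fix \<omega> :: "('n \<times> 'd) + 'n \<Rightarrow> real" and y
    have "mat_of (fun_upd \<omega> (Inr i) y) = (mat_of \<omega> :: real^'d^'n)" by (simp add: mat_of_def)
    moreover have "basic_solution A (vec_of (fun_upd \<omega> (Inr i) y)) K = basic_solution A (vec_of \<omega>) K" for A :: "real^'d^'n"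
      using that by (intro basic_solution_cong) (auto simp: vec_of_def)
    ultimately show "f K i (fun_upd \<omega> (Inr i) y) = f K i \<omega>" by (simp add: f_def)
  qed
  let ?I = "{(K, i). i \<notin> K} :: ('n set \<times> 'n) set"
  have "(\<Union>(K, i)\<in>?I. {\<omega>. \<omega> (Inr i) = f K i \<omega>}) \<in> null_sets ?M"
    using null by (intro null_sets_UN') (auto intro: countable_finite)
  then show ?thesis
  proof (rule that)
    fix \<omega> u assume \<omega>: "\<omega> \<notin> (\<Union>(K, i)\<in>?I. {\<omega>. \<omega> (Inr i) = f K i \<omega>})"
      and u: "u \<in> poly_vertices (polyhedron_of (mat_of \<omega>) (vec_of \<omega>))"
    show "card (tight_rows (mat_of \<omega>) (vec_of \<omega>) u) \<le> CARD('d)"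
    proof (rule ccontr)
      assume "\<not> ?thesis"
      then obtain i K where "i \<notin> K" "vec_of \<omega> $ i = mat_of \<omega> $ i \<bullet> basic_solution (mat_of \<omega>) (vec_of \<omega>) K"
        using degenerate_vertex_redundant_row[OF u] by auto
      then have "\<omega> (Inr i) = f K i \<omega>" by (simp add: f_def vec_of_def)
      with \<omega> \<open>i \<notin> K\<close> show False by auto
    qed
  qed
qed

subsection \<open>The lower bound\<close>

text \<open>The optimal face is compact and convex, so it has an extreme point, and extreme points
  of a face are extreme in \<open>P\<close>.\<close>

lemma maximizing_vertex_exists:
  fixes P :: "'a::euclidean_space set"
  assumes P: "compact P" "convex P" "P \<noteq> {}"
  obtains u where "u \<in> poly_vertices P" "\<And>x. x \<in> P \<Longrightarrow> c \<bullet> x \<le> c \<bullet> u"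
proof -
  have "continuous_on P (\<lambda>x. c \<bullet> x)" by (intro continuous_intros)
  then obtain m where m: "m \<in> P" "\<And>x. x \<in> P \<Longrightarrow> c \<bullet> x \<le> c \<bullet> m"
    using continuous_attains_sup[OF P(1,3)] by blast
  let ?F = "P \<inter> {x. c \<bullet> x = c \<bullet> m}"
  have face: "?F face_of P" using P m by (intro face_of_Int_supporting_hyperplane_le) auto
  have "compact ?F" using P by (intro compact_Int_closed closed_hyperplane)
  moreover have "convex ?F" using P by (intro convex_Int convex_hyperplane)
  ultimately obtain u where "u extreme_point_of ?F"
    using m extreme_point_exists_convex[of ?F] by blast
  then have "u extreme_point_of P" "u \<in> ?F" using extreme_point_of_face[OF face] by auto
  with m show ?thesis by (intro that[of u]) (auto simp: poly_vertices_def)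
qed

text \<open>With \<open>q\<close> the reciprocal of \<open>R\<close> and \<open>q \<le> r\<close>,
  the ratio \<open>R\<^sup>2 / r\<^sup>2\<close> is at most \<open>1 / q^4\<close>, hence at most
  \<open>1 + 72 * d * s\<close>. Since \<open>d \<le> 2 * (d - 1)\<close>, the excess is at most
  \<open>144 * (d - 1) * s\<close>, whose root has the coefficient 12; the factor 2 of the chord
  bound makes it 24.\<close>

lemma roundness_estimates:
  fixes s \<sigma> k :: real and d :: nat
  defines "r \<equiv> 1 - 2 * (9 / 4 * (d * s))"
  defines "R \<equiv> 1 / (r - \<sigma>\<^sup>2 / 2)"
  assumes d: "d \<ge> 2" and s: "0 < \<sigma>" "\<sigma> \<le> s" "d * s \<le> 1 / 32"
  shows "r - \<sigma>\<^sup>2 / 2 > 0" "r > 0" "sqrt (R\<^sup>2 - r\<^sup>2) < r"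
    and "(real d - 1) * r \<le> 2 * sqrt (R\<^sup>2 - r\<^sup>2) * k \<Longrightarrow> sqrt (real d - 1) / (24 * sqrt s) \<le> k"
proof -
  define y where "y = d * s"
  define q where "q = r - \<sigma>\<^sup>2 / 2"
  have y: "0 < y" "y \<le> 1/32" "2 * s \<le> y"
    using d s by (auto simp: y_def)
  have "\<sigma>\<^sup>2 \<le> s * (1/64)"
    unfolding power2_eq_square using s y by (intro mult_mono) auto
  then have "\<sigma>\<^sup>2 / 2 \<le> y / 256" using y by simp
  then have q: "1 - 23/5 * y \<le> q" "q \<le> r"
    using y by (auto simp: q_def r_def y_def[symmetric])
  then have q': "137/160 \<le> q" "q \<le> 1" using y by (auto simp: r_def y_def[symmetric])
  then show "r - \<sigma>\<^sup>2 / 2 > 0" and r: "r > 0" using q by (auto simp: q_def[symmetric])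
  \<comment> \<open>Here \<open>137/160\<close> is \<open>1 - 23/5 * y\<close> at the extreme value
    \<open>y = 1/32\<close>; its fourth power still exceeds one half.\<close>
  have "(137/160)^4 \<le> q^4" using q' by (intro power_mono) auto
  then have q4: "1/2 < q^4" by (rule less_le_trans[rotated]) (simp add: power4_eq_xxxx)
  have "1 - q^4 = (1 - q) * ((1 + q) * (1 + q\<^sup>2))" by (simp add: power4_eq_xxxx power2_eq_square algebra_simps)
  also have "\<dots> \<le> (1 - q) * (2 * 2)"
    using q' by (intro mult_left_mono mult_mono) (auto simp: power_le_one)
  also have "\<dots> \<le> 36 * y" using q y by simp
  also have "\<dots> \<le> 72 * y * q^4" using q4 y by simp
  finally have est: "1 \<le> (72 * y + 1) * q^4" by (simp add: algebra_simps)
  have R2: "R\<^sup>2 = 1 / q\<^sup>2" by (simp add: R_def q_def power_divide)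
  have le: "R\<^sup>2 \<le> t * r\<^sup>2" if "1 \<le> t * q^4" "t \<ge> 0" for t
  proof -
    have "R\<^sup>2 = 1 / q\<^sup>2" by (rule R2)
    also have "\<dots> \<le> t * q^4 / q\<^sup>2" using that by (intro divide_right_mono) auto
    also have "\<dots> = t * q\<^sup>2" using q' by (simp add: power4_eq_xxxx power2_eq_square)
    also have "\<dots> \<le> t * r\<^sup>2" using q q' that by (intro mult_left_mono power_mono) auto
    finally show ?thesis .
  qed
  define t where "t = 1 / q^4"
  have "q^4 > 0" using q4 by linarith
  then have "t < 2" "t \<ge> 0" "1 \<le> t * q^4" using q4 by (auto simp: t_def pos_divide_less_eq)
  then have "R\<^sup>2 \<le> t * r\<^sup>2" by (intro le)
  also have "\<dots> < 2 * r\<^sup>2" using \<open>t < 2\<close> r by simp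
  finally have "R\<^sup>2 < 2 * r\<^sup>2" .
  then have "R\<^sup>2 - r\<^sup>2 < r\<^sup>2" by simp
  then show "sqrt (R\<^sup>2 - r\<^sup>2) < r" using r by (intro real_less_lsqrt) auto
  assume k: "(real d - 1) * r \<le> 2 * sqrt (R\<^sup>2 - r\<^sup>2) * k"
  define h where "h = sqrt (real d - 1)"
  have h: "h > 0" "h * h = real d - 1" using d by (auto simp: h_def)
  have "0 < (real d - 1) * r" using d r by simp
  with k have "0 < (2 * sqrt (R\<^sup>2 - r\<^sup>2)) * k" by linarith
  \<comment> \<open>The real \<open>sqrt\<close> is negative at negative arguments, so this needs
    \<open>r \<le> R\<close>.\<close>
  moreover have "0 \<le> sqrt (R\<^sup>2 - r\<^sup>2)"
  proof -
    have "r * q \<le> 1" using q q' r y by (intro mult_le_one) (auto simp: r_def y_def[symmetric])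
    then have "r \<le> R" using q' by (simp add: R_def q_def[symmetric] field_simps)
    then show ?thesis using r by (simp add: power_mono)
  qed
  ultimately have k0: "k > 0" by (simp add: zero_less_mult_iff)
  have "R\<^sup>2 - r\<^sup>2 \<le> 72 * y * r\<^sup>2" using le[OF est] y by (simp add: algebra_simps)
  also have "\<dots> \<le> 144 * ((real d - 1) * s) * r\<^sup>2"
  proof -
    have "real d \<le> 2 * (real d - 1)" using d by simp
    then have "y \<le> 2 * (real d - 1) * s" unfolding y_def using s by (intro mult_right_mono) auto
    then have "72 * y \<le> 144 * ((real d - 1) * s)" by (simp add: algebra_simps)
    then show ?thesis by (rule mult_right_mono) simp
  qed
  also have "\<dots> = (12 * (h * sqrt s) * r)\<^sup>2"
  proof -
    have "(12 * (h * sqrt s) * r)\<^sup>2 = 144 * ((h * h) * (sqrt s)\<^sup>2) * r\<^sup>2"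
      by (simp add: power2_eq_square)
    then show ?thesis using h s by simp
  qed
  finally have "sqrt (R\<^sup>2 - r\<^sup>2) \<le> 12 * (h * sqrt s) * r"
    using h s r by (intro real_le_lsqrt) auto
  then have "2 * sqrt (R\<^sup>2 - r\<^sup>2) * k \<le> 2 * (12 * (h * sqrt s) * r) * k"
    using k0 by (intro mult_right_mono mult_left_mono) auto
  moreover have "(h * r) * h = (real d - 1) * r" unfolding h(2)[symmetric] by (simp only: mult_ac)
  moreover have "2 * (12 * (h * sqrt s) * r) * k = (h * r) * (24 * sqrt s * k)" by simp
  ultimately have "(h * r) * h \<le> (h * r) * (24 * sqrt s * k)" using k by linarith
  moreover have "h * r > 0" using h r by simp
  ultimately have "h \<le> 24 * sqrt s * k" by (simp only: mult_le_cancel_left_pos)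
  then show "sqrt (real d - 1) / (24 * sqrt s) \<le> k"
    using s by (simp add: h_def field_simps)
qed

text \<open>The hypothesis on \<open>\<sigma>\<close> also holds for \<open>\<sigma>\<close> slightly below 4, where the logarithm is small; there \<open>n = 1\<close>.\<close>

lemma smoothed_parameters:
  fixes \<sigma> :: real and d n :: nat
  assumes d: "d \<ge> 2" and s: "\<sigma> > 0" and le: "\<sigma> * sqrt (ln (4 / \<sigma>)) \<le> 1 / (32 * real d)"
    and n: "n = nat \<lfloor>(4 / \<sigma>) ^ d\<rfloor>" "n > 1"
  shows "\<sigma> \<le> \<sigma> * sqrt (ln (4 / \<sigma>))" "\<sigma> \<le> 1 / 64" "8 * ln 2 \<le> ln (4 / \<sigma>)"
proof -
  have "1 \<le> (4 / \<sigma>) ^ d" using n by linarith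
  then have "1 \<le> 4 / \<sigma>"
    using power_strict_mono[of "4 / \<sigma>" 1 d] s d by (cases "4 / \<sigma> < 1") auto
  then have L0: "ln (4 / \<sigma>) \<ge> 0" by simp
  have exp_L: "(4 / \<sigma>) ^ d = exp (d * ln (4 / \<sigma>))"
    using s by (simp add: exp_of_nat_mult)
  have "\<sigma> < 1"
  proof (rule ccontr)
    \<comment> \<open>A large \<open>\<sigma>\<close> makes the logarithm so small that
      \<open>(4 / \<sigma>) ^ d\<close> is below 2, against \<open>n > 1\<close>.\<close>
    assume "\<not> \<sigma> < 1"
    then have "1 * sqrt (ln (4 / \<sigma>)) \<le> \<sigma> * sqrt (ln (4 / \<sigma>))" using L0 by (intro mult_right_mono) auto
    with le have "sqrt (ln (4 / \<sigma>)) \<le> 1 / (32 * real d)" by simp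
    then have "ln (4 / \<sigma>) \<le> (1 / (32 * real d))\<^sup>2" using L0 by (simp add: sqrt_le_D)
    then have "d * ln (4 / \<sigma>) \<le> d * (1 / (32 * real d))\<^sup>2" by (intro mult_left_mono) auto
    also have "\<dots> = 1 / (1024 * real d)" using d by (simp add: power2_eq_square field_simps)
    also have "\<dots> \<le> 1 / 2" using d by (simp add: field_simps)
    finally have dL: "d * ln (4 / \<sigma>) \<le> 1 / 2" .
    have "(4 / \<sigma>) ^ d \<le> exp (1 / 2)" unfolding exp_L using dL by simp
    also have "exp (1 / 2 :: real) \<le> 1 + 1 / 2 + (1 / 2)\<^sup>2" by (rule exp_bound) auto
    also have "\<dots> < 2" by (simp add: power2_eq_square)
    finally have "\<lfloor>(4 / \<sigma>) ^ d\<rfloor> < 2" by linarith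
    with n show False by simp
  qed
  have "exp 1 \<le> (1::real) + 1 + 1\<^sup>2" by (rule exp_bound) auto
  also have "\<dots> \<le> 4 / \<sigma>" using \<open>\<sigma> < 1\<close> s by (simp add: field_simps)
  finally have "1 \<le> ln (4 / \<sigma>)" using s by (subst ln_ge_iff) auto
  then show \<sigma>s: "\<sigma> \<le> \<sigma> * sqrt (ln (4 / \<sigma>))" using s by simp
  also have "\<dots> \<le> 1 / (32 * real d)" by (rule le)
  also have "\<dots> \<le> 1 / 64" using d by (simp add: field_simps)
  finally show "\<sigma> \<le> 1 / 64" .
  then have "2 ^ 8 \<le> 4 / \<sigma>" using s by (simp add: field_simps)
  then have "ln (2 ^ 8) \<le> ln (4 / \<sigma>)" using s by (subst ln_le_cancel_iff) auto
  then show "8 * ln 2 \<le> ln (4 / \<sigma>)" using ln_realpow[of 2 8] by simp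
qed

text \<open>The claim amounts to
  \<open>(2 * n) ^ (d + 1) \<le> exp (243/128 * d\<^sup>2 * L)\<close>, where
  \<open>243/128 = 3/8 * (9/4)\<^sup>2\<close>. With \<open>n \<le> exp (d * L)\<close> and
  \<open>2 \<le> exp (L / 8)\<close> it reduces to
  \<open>(d + 1) * (d + 1/8) \<le> 243/128 * d\<^sup>2\<close>. The worst case is
  \<open>d = 2\<close>, which the coefficient 9/4 passes and 2 would fail.\<close>

lemma noise_tail_estimate:
  fixes \<sigma> :: real and d n :: nat
  defines "L \<equiv> ln (4 / \<sigma>)"
  assumes d: "d \<ge> 2" and s: "\<sigma> > 0" and n: "0 < n" "real n \<le> (4 / \<sigma>) ^ d" and L: "8 * ln 2 \<le> L"
  shows "real n * (2 ^ (d + 1) * exp (- (3 * (9 / 4 * (d * (\<sigma> * sqrt L)))\<^sup>2 / (8 * \<sigma>\<^sup>2)))) \<le> 1 / real n ^ d"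
proof -
  have "L \<ge> 0" using L ln_gt_zero[of "2::real"] by linarith
  then have expo: "3 * (9 / 4 * (d * (\<sigma> * sqrt L)))\<^sup>2 / (8 * \<sigma>\<^sup>2) = 243 / 128 * (d\<^sup>2 * L)"
    using s by (simp add: power_mult_distrib field_simps)
  have "2 * real n \<le> exp (L / 8) * exp (d * L)"
  proof (rule mult_mono)
    have "exp (ln 2) \<le> exp (L / 8)" using L by (subst exp_le_cancel_iff) simp
    then show "2 \<le> exp (L / 8)" by simp
    have "exp (d * L) = (4 / \<sigma>) ^ d" using s by (simp add: exp_of_nat_mult L_def)
    with n show "real n \<le> exp (d * L)" by simp
  qed auto
  then have "(2 * real n) ^ (d + 1) \<le> (exp (L / 8) * exp (d * L)) ^ (d + 1)"
    by (intro power_mono) auto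
  also have "\<dots> = exp (real (d + 1) * (L / 8 + d * L))"
    by (simp only: exp_add[symmetric] exp_of_nat_mult[symmetric])
  also have "\<dots> \<le> exp (243 / 128 * (d\<^sup>2 * L))"
  proof -
    have "(real d + 1) * (1 / 8 + real d) \<le> 243 / 128 * (real d)\<^sup>2"
    proof -
      have "2 * real d \<le> (real d)\<^sup>2" "4 \<le> (real d)\<^sup>2"
        using d mult_mono[of 2 "real d" 2 "real d"] by (auto simp: power2_eq_square)
      moreover have "(real d + 1) * (1 / 8 + real d) = (real d)\<^sup>2 + 9 / 8 * real d + 1 / 8"
        by (simp add: power2_eq_square field_simps)
      ultimately show ?thesis by linarith
    qed
    then have "((real d + 1) * (1 / 8 + real d)) * L \<le> (243 / 128 * (real d)\<^sup>2) * L"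
      using \<open>L \<ge> 0\<close> by (rule mult_right_mono)
    then show ?thesis by (simp add: algebra_simps)
  qed
  finally have "(2 * real n) ^ (d + 1) * exp (- (243 / 128 * (d\<^sup>2 * L))) \<le> 1"
    by (simp add: exp_minus field_simps)
  then have "real n ^ d * (real n * (2 ^ (d + 1) * exp (- (243 / 128 * (d\<^sup>2 * L))))) \<le> 1"
    by (simp add: power_mult_distrib mult_ac)
  then show ?thesis
    unfolding expo using n by (simp add: field_simps)
qed

text \<open>The deterministic core: chance enters only through \<open>noise\<close> and
  \<open>nondeg\<close>. The diameter bound is the distance bound for an arbitrary objective, whose
  optimal vertices exist because \<open>P\<close> is compact and contains the origin.\<close>

lemma comb_dist_perturbed_ball:
  fixes A :: "real^'d^'n" and b :: "real^'n" and w :: "'n \<Rightarrow> real^'d" and s \<sigma> :: real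
  defines "P \<equiv> polyhedron_of A b"
    and "B \<equiv> sqrt (real CARD('d) - 1) / (24 * sqrt s)"
    and "\<alpha> \<equiv> 1 / sqrt 2"
  assumes d: "CARD('d) \<ge> 2" and s: "0 < \<sigma>" "\<sigma> \<le> s" "CARD('d) * s \<le> 1 / 32"
    and w: "\<And>i. norm (w i) = 1" and net: "\<And>x. norm x = 1 \<Longrightarrow> \<exists>i. dist x (w i) < \<sigma>"
    and noise: "\<And>i. (norm (A $ i - \<alpha> *\<^sub>R w i))\<^sup>2 + (b $ i - \<alpha>)\<^sup>2 \<le> (9 / 4 * (CARD('d) * s))\<^sup>2"
    and nondeg: "\<And>u. u \<in> poly_vertices P \<Longrightarrow> card (tight_rows A b u) \<le> CARD('d)"
  shows "\<lbrakk>c \<noteq> 0; u \<in> poly_vertices P; \<And>x. x \<in> P \<Longrightarrow> c \<bullet> x \<le> c \<bullet> u;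
      v \<in> poly_vertices P; \<And>x. x \<in> P \<Longrightarrow> c \<bullet> v \<le> c \<bullet> x\<rbrakk> \<Longrightarrow> ereal B \<le> ereal_of_enat (comb_dist P u v)"
    and "ereal B \<le> ereal_of_enat (comb_diam P)"
proof -
  define t where "t = 9 / 4 * (CARD('d) * s)"
  have t: "0 \<le> t" "2 * t + \<sigma>\<^sup>2 / 2 < 1"
    using roundness_estimates(1)[OF d s] s by (auto simp: t_def)
  note bounds = perturbed_ball_bounds[OF w net t noise[unfolded \<alpha>_def, folded t_def]]
  note est = roundness_estimates[OF d s, folded t_def]
  show dist: "ereal B \<le> ereal_of_enat (comb_dist P u v)"
    if c: "c \<noteq> 0" and u: "u \<in> poly_vertices P" "\<And>x. x \<in> P \<Longrightarrow> c \<bullet> x \<le> c \<bullet> u"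
      and v: "v \<in> poly_vertices P" "\<And>x. x \<in> P \<Longrightarrow> c \<bullet> v \<le> c \<bullet> x" for c u v
    unfolding ereal_le_ereal_of_enat_iff comb_dist_ge_iff
  proof (intro allI impI)
    fix k assume walk: "poly_walk P u v k"
    have "(real CARD('d) - 1) * (1 - 2 * t) \<le>
        2 * sqrt ((1 / (1 - 2 * t - \<sigma>\<^sup>2 / 2))\<^sup>2 - (1 - 2 * t)\<^sup>2) * real k"
      using bounds est(2,3) nondeg d c u v walk unfolding P_def
      by (intro walk_length_round[where A = A and b = b]) auto
    then have "B \<le> real k" unfolding B_def by (rule est(4))
    then show "nat \<lceil>B\<rceil> \<le> k" by (simp add: nat_le_iff ceiling_le_iff)
  qed
  have "bounded P"
    using bounds(3) unfolding P_def bounded_iff by blast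
  then have P: "compact P" "convex P"
    by (auto simp: P_def compact_eq_bounded_closed closed_polyhedron_of convex_polyhedron_of)
  have "0 \<in> P"
    unfolding P_def polyhedron_of_iff
  proof
    fix i
    have "0 \<le> norm (A $ i) * (1 - 2 * t)" using est(2) by simp
    also have "\<dots> \<le> b $ i" by (rule bounds(2))
    finally show "A $ i \<bullet> 0 \<le> b $ i" by simp
  qed
  then have ne: "P \<noteq> {}" by blast
  obtain c :: "real^'d" where c: "c \<noteq> 0" using vector_choose_size[of 1] by (metis norm_zero zero_neq_one zero_le_one)
  obtain u where u: "u \<in> poly_vertices P" "\<And>x. x \<in> P \<Longrightarrow> c \<bullet> x \<le> c \<bullet> u"
    using maximizing_vertex_exists[OF P ne] by blast
  obtain v where v: "v \<in> poly_vertices P" "\<And>x. x \<in> P \<Longrightarrow> - c \<bullet> x \<le> - c \<bullet> v"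
    using maximizing_vertex_exists[OF P ne] by blast
  have "enat (nat \<lceil>B\<rceil>) \<le> comb_dist P u v"
    using dist[OF c u v(1)] v(2) by (auto simp: ereal_le_ereal_of_enat_iff)
  with u(1) v(1) show "ereal B \<le> ereal_of_enat (comb_diam P)"
    unfolding ereal_le_ereal_of_enat_iff comb_diam_ge_iff by blast
qed

theorem theorem5p5:
  fixes \<sigma> :: real
  assumes "CARD('d::finite) \<ge> 2"
    and "\<sigma> > 0"
    and "\<sigma> * sqrt (ln (4 / \<sigma>)) \<le> 1 / (32 * real CARD('d))"
    and "CARD('n::finite) = nat \<lfloor>(4 / \<sigma>) ^ CARD('d)\<rfloor>"
  shows "\<exists>(Abar :: real^'d^'n) (bbar :: real^'n).
    (\<forall>i. (norm (Abar $ i))\<^sup>2 + (bbar $ i)\<^sup>2 \<le> 1) \<and>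
    (let M = gauss_model Abar bbar \<sigma>;
         n = real CARD('n); d = CARD('d);
         B = sqrt (real d - 1) / (24 * sqrt (\<sigma> * sqrt (ln (4 / \<sigma>))))
     in measure M {\<omega> \<in> space M.
            ereal_of_enat (comb_diam (polyhedron_of (mat_of \<omega>) (vec_of \<omega>))) \<ge> ereal B}
          \<ge> 1 - 1 / n ^ d
      \<and> measure M {\<omega> \<in> space M.
            \<forall>c :: real^'d. c \<noteq> 0 \<longrightarrow>
              (\<forall>u v. let P = polyhedron_of (mat_of \<omega>) (vec_of \<omega>) in
                 u \<in> poly_vertices P \<and> (\<forall>x\<in>P. c \<bullet> x \<le> c \<bullet> u) \<and>
                 v \<in> poly_vertices P \<and> (\<forall>x\<in>P. c \<bullet> v \<le> c \<bullet> x) \<longrightarrow>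
                 ereal_of_enat (comb_dist P u v) \<ge> ereal B)}
          \<ge> 1 - 1 / n ^ d)"
proof (cases "CARD('n) = 1")
  \<comment> \<open>For \<open>n = 1\<close> the required probability is 0, and any means will
    do.\<close>
  case True
  then show ?thesis
    by (intro exI[of _ 0]) (simp add: Let_def)
next
  case False
  then have n1: "CARD('n) > 1" using zero_less_card_finite[where 'a = 'n] by linarith
  define d where "d = CARD('d)"
  define s where "s = \<sigma> * sqrt (ln (4 / \<sigma>))"
  define B where "B = sqrt (real d - 1) / (24 * sqrt s)"
  define t where "t = 9 / 4 * (d * s)"
  define \<alpha> where "\<alpha> = 1 / sqrt (2::real)"
  note param = smoothed_parameters[OF assms n1]
  have n_le: "real CARD('n) \<le> (4 / \<sigma>) ^ d"
    using assms(2,4) by (simp add: d_def)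
  \<comment> \<open>The packing bound fits below \<open>n + 1\<close> because
    \<open>\<sigma> \<le> 2\<close>; the rounding in \<open>n\<close> costs less than one.\<close>
  have "(1 + 2 / \<sigma>) ^ CARD('d) \<le> (4 / \<sigma>) ^ CARD('d)"
    using assms(2) param(2) by (intro power_mono) (auto simp: field_simps)
  also have "\<dots> < real CARD('n) + 1" unfolding assms(4) by linarith
  finally obtain w :: "'n \<Rightarrow> real^'d" where w: "\<And>i. norm (w i) = 1"
    and net: "\<And>x. norm x = 1 \<Longrightarrow> \<exists>i. dist x (w i) < \<sigma>"
    using sphere_net_exists[OF assms(2)] by blast
  define A0 :: "real^'d^'n" where "A0 = (\<chi> i. \<alpha> *\<^sub>R w i)"
  define b0 :: "real^'n" where "b0 = (\<chi> i. \<alpha>)"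
  let ?M = "gauss_model A0 b0 \<sigma>"
  interpret prob_space ?M by (rule prob_space_gauss_model[OF assms(2)])
  define F where "F i = {\<omega>. t\<^sup>2 \<le> (norm (mat_of \<omega> $ i - A0 $ i))\<^sup>2 + (vec_of \<omega> $ i - b0 $ i)\<^sup>2}" for i
  obtain N where N: "N \<in> null_sets ?M"
    and nondeg: "\<And>\<omega> u. \<omega> \<notin> N \<Longrightarrow> u \<in> poly_vertices (polyhedron_of (mat_of \<omega>) (vec_of \<omega>)) \<Longrightarrow>
      card (tight_rows (mat_of \<omega>) (vec_of \<omega>) u) \<le> CARD('d)"
    using null_sets_gauss_degenerate[OF assms(2)] by blast
  have comp [measurable]: "(\<lambda>\<omega>. mat_of \<omega> $ i $ j) \<in> borel_measurable ?M"
      "(\<lambda>\<omega>. vec_of \<omega> $ i) \<in> borel_measurable ?M" for i j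
    by (simp_all add: mat_of_def vec_of_def)
  have F_sets: "F i \<in> sets ?M" for i
  proof -
    have "{\<omega> \<in> space ?M. t\<^sup>2 \<le> (norm (mat_of \<omega> $ i - A0 $ i))\<^sup>2 + (vec_of \<omega> $ i - b0 $ i)\<^sup>2} \<in> sets ?M"
      unfolding power2_norm_eq_inner inner_vec_def vector_minus_component inner_real_def
      by measurable
    then show ?thesis by (simp add: F_def space_gauss_model)
  qed
  \<comment> \<open>One exceptional set serves both events; degeneracy adds nothing to its
    probability.\<close>
  define bad where "bad = N \<union> (\<Union>i. F i)"
  have bad_sets: "bad \<in> sets ?M" using N F_sets by (auto simp: bad_def)
  have "prob bad \<le> prob N + prob (\<Union>i. F i)"
    unfolding bad_def using N F_sets by (intro measure_Un_le) auto
  moreover have "prob N = 0" using N by (rule measure_eq_0_null_sets)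
  moreover have "prob (\<Union>i. F i) \<le> (\<Sum>i\<in>UNIV. prob (F i))"
    using F_sets by (intro finite_measure_subadditive_finite) auto
  moreover have "(\<Sum>i\<in>UNIV. prob (F i)) \<le> (\<Sum>i\<in>(UNIV::'n set). 2 ^ (d + 1) * exp (- (3 * t\<^sup>2 / (8 * \<sigma>\<^sup>2))))"
    unfolding F_def d_def by (intro sum_mono prob_gauss_row_noise_ge assms)
  moreover have "(\<Sum>i\<in>(UNIV::'n set). 2 ^ (d + 1) * exp (- (3 * t\<^sup>2 / (8 * \<sigma>\<^sup>2)))) =
      real CARD('n) * (2 ^ (d + 1) * exp (- (3 * t\<^sup>2 / (8 * \<sigma>\<^sup>2))))"
    by (rule sum_constant)
  moreover have "real CARD('n) * (2 ^ (d + 1) * exp (- (3 * t\<^sup>2 / (8 * \<sigma>\<^sup>2)))) \<le> 1 / real CARD('n) ^ d"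
    unfolding t_def s_def
  proof (rule noise_tail_estimate)
    show "d \<ge> 2" using assms(1) by (simp add: d_def)
  qed (use assms(2) n1 n_le param(3) in simp_all)
  ultimately have bad: "prob bad \<le> 1 / real CARD('n) ^ d" by linarith
  have large: "1 - 1 / real CARD('n) ^ d \<le> prob E" if "E \<in> sets ?M" "- bad \<subseteq> E" for E
  proof -
    have "1 - prob bad = prob (space ?M - bad)" using bad_sets by (simp add: prob_compl)
    also have "\<dots> \<le> prob E" using that by (intro finite_measure_mono) auto
    finally show ?thesis using bad by linarith
  qed
  have s32: "real CARD('d) * s \<le> 1 / 32"
    using assms(1,3) by (simp add: s_def field_simps)
  have good: "(norm (mat_of \<omega> $ i - (1 / sqrt 2) *\<^sub>R w i))\<^sup>2 + (vec_of \<omega> $ i - 1 / sqrt 2)\<^sup>2 \<le> (9 / 4 * (CARD('d) * s))\<^sup>2"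
    if "\<omega> \<notin> bad" for \<omega> i
    using that by (auto simp: bad_def F_def A0_def b0_def \<alpha>_def t_def d_def not_le intro: less_imp_le)
  note ball = comb_dist_perturbed_ball[where w = w, OF assms(1,2) param(1)[folded s_def] s32 w]
  have "1 - 1 / real CARD('n) ^ d \<le> prob {\<omega> \<in> space ?M.
      ereal B \<le> ereal_of_enat (comb_diam (polyhedron_of (mat_of \<omega>) (vec_of \<omega>)))}"
  proof (intro large sets_comb_diam_ge comp subsetI)
    fix \<omega> assume \<omega>: "\<omega> \<in> - bad"
    then have "\<omega> \<notin> bad" "\<omega> \<notin> N" by (auto simp: bad_def)
    then have "ereal B \<le> ereal_of_enat (comb_diam (polyhedron_of (mat_of \<omega>) (vec_of \<omega>)))"
      unfolding B_def d_def by (intro ball(2) net good nondeg)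
    then show "\<omega> \<in> {\<omega> \<in> space ?M. ereal B \<le> ereal_of_enat (comb_diam (polyhedron_of (mat_of \<omega>) (vec_of \<omega>)))}"
      by (simp add: space_gauss_model)
  qed
  moreover have "1 - 1 / real CARD('n) ^ d \<le> prob {\<omega> \<in> space ?M. \<forall>c :: real^'d. c \<noteq> 0 \<longrightarrow>
              (\<forall>u v. let P = polyhedron_of (mat_of \<omega>) (vec_of \<omega>) in
                 u \<in> poly_vertices P \<and> (\<forall>x\<in>P. c \<bullet> x \<le> c \<bullet> u) \<and>
                 v \<in> poly_vertices P \<and> (\<forall>x\<in>P. c \<bullet> v \<le> c \<bullet> x) \<longrightarrow>
                 ereal B \<le> ereal_of_enat (comb_dist P u v))}" (is "_ \<le> prob ?E")
  proof (intro large sets_comb_dist_optimal_ge comp subsetI)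
    fix \<omega> assume \<omega>: "\<omega> \<in> - bad"
    then have "\<omega> \<notin> bad" "\<omega> \<notin> N" by (auto simp: bad_def)
    then have "ereal B \<le> ereal_of_enat (comb_dist P u v)"
      if "P = polyhedron_of (mat_of \<omega>) (vec_of \<omega>)" "c \<noteq> 0"
        "u \<in> poly_vertices P" "\<forall>x\<in>P. c \<bullet> x \<le> c \<bullet> u" "v \<in> poly_vertices P" "\<forall>x\<in>P. c \<bullet> v \<le> c \<bullet> x"
      for P and c u v :: "real^'d"
      unfolding that(1) B_def d_def using that
      by (intro ball(1)[of "mat_of \<omega>" "vec_of \<omega>" c u v] net good nondeg) auto
    then show "\<omega> \<in> ?E" by (simp add: space_gauss_model Let_def)
  qed
  moreover have "(norm (A0 $ i))\<^sup>2 + (b0 $ i)\<^sup>2 \<le> 1" for i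
    using w[of i] by (simp add: A0_def b0_def \<alpha>_def power_divide)
  ultimately show ?thesis
    unfolding Let_def B_def d_def s_def by blast
qed

end
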